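(* Let $a,b$ be positive integers of opposite parity and let $p$ be a prime with $p\geq a+b+2$. Then $$\sum_{i=1}^{p-1}H_i^{(a)}H_i^{(b)}\equiv-\frac{k_{a,b}}{2(a+b)}\,p\,B_{p-a-b}\pmod{p^2},$$ where $k_{a,b}=(-1)^a\left[\binom{a+b+1}{b}-\binom{a+b+1}{a}\right]$.
   Context: For an integer $r$ and a positive integer $n$, $H_n^{(r)}=\sum_{k=1}^n k^{-r}$ is the generalized harmonic number. $B_n$ denotes the $n$-th Bernoulli number. Congruences are between rational numbers whose denominators are not divisible by $p$: $\frac mn\equiv\frac rs \pmod{p^k}$ means $ms\equiv nr\pmod{p^k}$, where $n,s$ are not divisible by $p$. *)

theory Defs
  imports
    "HOL-Number_Theory.Number_Theory"
    "HOL-Computational_Algebra.Formal_Power_Series"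
begin

definition gen_harmonic :: "int \<Rightarrow> nat \<Rightarrow> rat" where
  "gen_harmonic r n = (\<Sum>k=1..n. of_nat k powi (- r))"

(* The convention with B_1 = -1/2, i.e. exponential generating function t / (e^t - 1);
   see bernoulli_egf. *)
fun bernoulli :: "nat \<Rightarrow> rat" where
  "bernoulli 0 = 1"
| "bernoulli (Suc n) =
     - (\<Sum>k\<le>n. of_nat ((n + 2) choose k) * bernoulli k) / of_nat (n + 2)"

declare bernoulli.simps(2) [simp del]

lemma sum_binomial_bernoulli:
  "(\<Sum>k\<le>n. of_nat (Suc n choose k) * bernoulli k) = (if n = 0 then 1 else 0)"
proof (cases n)
  case (Suc m)
  have "of_nat (m + 2) * bernoulli (Suc m) =
      - (\<Sum>k\<le>m. of_nat ((m + 2) choose k) * bernoulli k)"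
    by (simp add: bernoulli.simps(2) del: of_nat_add of_nat_Suc)
  moreover have "Suc (Suc m) choose Suc m = m + 2"
    using binomial_symmetric[of "Suc m" "Suc (Suc m)"] by simp
  ultimately show ?thesis
    using Suc by (simp del: binomial_Suc_Suc of_nat_add of_nat_Suc)
qed auto

lemma bernoulli_egf:
  "Abs_fps (\<lambda>n. bernoulli n / fact n) * (fps_exp 1 - 1) = fps_X"
proof (rule fps_ext)
  fix n
  show "fps_nth (Abs_fps (\<lambda>n. bernoulli n / fact n) * (fps_exp 1 - 1)) n = fps_nth fps_X n"
  proof (cases n)
    case (Suc m)
    have "fps_nth (Abs_fps (\<lambda>n. bernoulli n / fact n) * (fps_exp 1 - 1)) (Suc m)
        = (\<Sum>k\<le>m. bernoulli k / fact k * (1 / fact (Suc m - k)))"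
      by (auto simp: fps_mult_nth atLeast0AtMost intro!: sum.cong)
    also have "\<dots> = (\<Sum>k\<le>m. of_nat (Suc m choose k) * bernoulli k) / fact (Suc m)"
      unfolding sum_divide_distrib
      by (intro sum.cong refl)
         (simp add: binomial_fact field_simps del: fact_Suc binomial_Suc_Suc)
    finally show ?thesis
      using Suc by (simp add: sum_binomial_bernoulli del: binomial_Suc_Suc)
  qed (simp add: fps_mult_nth)
qed

(* Congruence modulo p ^ k between rationals whose denominators are prime to p. It implies that
   both sides have such a representation, so it never holds for other rationals. *)
definition rat_cong :: "nat \<Rightarrow> nat \<Rightarrow> rat \<Rightarrow> rat \<Rightarrow> bool" where
  "rat_cong p k x y \<longleftrightarrow>
     (\<exists>m n r s :: int. \<not> int p dvd n \<and> \<not> int p dvd s \<and>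
        x = of_int m / of_int n \<and> y = of_int r / of_int s \<and>
        [m * s = n * r] (mod int p ^ k))"

definition coeff_k :: "nat \<Rightarrow> nat \<Rightarrow> int" where
  "coeff_k a b = (- 1) ^ a * (int ((a + b + 1) choose b) - int ((a + b + 1) choose a))"

end

theory Submission
  imports Defs
begin

text \<open>
  Write \<open>A\<close>, \<open>B\<close> for the harmonic numbers of orders \<open>a\<close>, \<open>b\<close>, let \<open>S\<close> be the sum of \<open>A i * B i\<close>, and
  put \<open>w = a + b\<close>. Since everything is symmetric in \<open>a\<close> and \<open>b\<close>, let \<open>a\<close> be even and \<open>b\<close> odd.

  The idea is to sum in the opposite direction. Expanding \<open>(p - j) powi (- a)\<close> to first order in \<open>p\<close>
  gives \<open>A (p-1-i)\<close> as \<open>A (p-1) - (A i + p a A' i)\<close> modulo \<open>p\<^sup>2\<close>, where \<open>A'\<close> has order \<open>a + 1\<close>, and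
  \<open>B (p-1-i)\<close> in the same way but with the opposite sign. The two signs multiply to \<open>- 1\<close>, so the
  substitution turns \<open>S\<close> into \<open>- S\<close> plus corrections: \<open>2 S\<close> is congruent to
  \<open>- p (a M(a+1,b) + b M(a,b+1)) + A (p-1) * (\<Sum>i. B i)\<close>, where \<open>M(x,y)\<close> is the sum of products for
  the orders \<open>x\<close>, \<open>y\<close> (lemma \<open>twice_harmonic_product_sum\<close>). The factor \<open>p\<close> in front means that the sums
  \<open>M\<close> matter only modulo \<open>p\<close>.

  Modulo \<open>p\<close>, Abel summation reduces \<open>M(x,y)\<close> to nested sums of \<open>j powi (- x) * k powi (- t)\<close> over
  \<open>j < k\<close>. By Fermat's theorem the inner sum is a sum of positive powers, which Faulhaber's formula
  writes as a polynomial in \<open>k\<close> with Bernoulli numbers as coefficients; in the sum over \<open>k\<close> only the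
  monomial whose exponent is a multiple of \<open>p - 1\<close> survives. Hence one Bernoulli number remains, and
  it is always the one with index \<open>p - w\<close> (lemma \<open>nested_sum_cong\<close>). An identity between binomial
  coefficients then collects the four contributions.

  The case \<open>b = 1\<close> is exceptional twice: one nested sum has \<open>t = 0\<close> and vanishes instead of following the
  general formula, and \<open>\<Sum>i. B i\<close> is \<open>1\<close> instead of \<open>0\<close> modulo \<open>p\<close>. These two deviations cancel because
  \<open>A (p-1)\<close> is congruent to \<open>a / (a + 1) * p * bernoulli (p - 1 - a)\<close> modulo \<open>p\<^sup>2\<close>
  (lemma \<open>power_sum_negative\<close>), which rests on a comparison of power sums with congruent exponents
  (lemma \<open>power_sum_kummer\<close>).
\<close>

section \<open>Faulhaber's formula and two summation identities\<close>

text \<open>Both sides count the pairs of disjoint subsets of sizes \<open>r\<close> and \<open>s\<close> of a set with \<open>m\<close> elements.\<close>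

lemma choose_mult_choose_swap:
  assumes "r + s \<le> m"
  shows "(m choose r) * (m - r choose s) = (m choose s) * (m - s choose r)"
proof -
  have "(m choose r) * (m - r choose s) * (fact r * fact s * fact (m - r - s)) = fact m"
    if "r + s \<le> m" for r s :: nat
  proof -
    have "fact r * fact (m - r) * (m choose r) = fact m"
      "fact s * fact (m - r - s) * (m - r choose s) = fact (m - r)"
      using that binomial_fact_lemma[of r m] binomial_fact_lemma[of s "m - r"]
      by (simp_all add: mult.assoc)
    thus ?thesis by (metis mult.assoc mult.commute mult.left_commute)
  qed
  from this[of r s] this[of s r]
  have "(m choose r) * (m - r choose s) * (fact r * fact s * fact (m - r - s)) =
      (m choose s) * (m - s choose r) * (fact r * fact s * fact (m - r - s))"
    using assms by (simp add: add.commute mult.commute)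
  thus ?thesis by (simp only: mult_right_cancel mult_eq_0_iff fact_nonzero simp_thms)
qed

lemma power_Suc_diff_expand:
  fixes x :: rat
  shows "(x + 1) ^ Suc m - x ^ Suc m = (\<Sum>s\<le>m. of_nat (Suc m choose s) * x ^ s)"
  by (subst binomial_ring) (simp del: binomial_Suc_Suc)

text \<open>The Bernoulli polynomial identity \<open>B(x + 1) - B(x) = (n + 1) x ^ n\<close>, up to the constant term of \<open>B\<close>.
  After expanding the differences and exchanging the two sums, the coefficient of \<open>x ^ s\<close> is a multiple
  of the sum in the recursion for the Bernoulli numbers, which vanishes unless \<open>s = n\<close>.\<close>

lemma faulhaber_step:
  fixes x :: rat
  shows "(\<Sum>r\<le>n. of_nat (Suc n choose r) * bernoulli r * ((x + 1) ^ (Suc n - r) - x ^ (Suc n - r))) =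
    of_nat (Suc n) * x ^ n"
proof -
  define T where "T r s = of_nat (Suc n choose s) * x ^ s * (of_nat (Suc n - s choose r) * bernoulli r)"
    for r s
  have "(\<Sum>r\<le>n. of_nat (Suc n choose r) * bernoulli r * ((x + 1) ^ (Suc n - r) - x ^ (Suc n - r))) =
      (\<Sum>r\<le>n. \<Sum>s\<le>n-r. T r s)"
  proof (rule sum.cong[OF refl])
    fix r assume r: "r \<in> {..n}"
    hence "Suc n - r = Suc (n - r)" by auto
    hence "of_nat (Suc n choose r) * bernoulli r * ((x + 1) ^ (Suc n - r) - x ^ (Suc n - r)) =
      (\<Sum>s\<le>n-r. bernoulli r * x ^ s * of_nat ((Suc n choose r) * (Suc n - r choose s)))"
      by (simp only: power_Suc_diff_expand sum_distrib_left of_nat_mult) (simp add: mult_ac)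
    also have "\<dots> = (\<Sum>s\<le>n-r. T r s)"
    proof (rule sum.cong[OF refl])
      fix s assume "s \<in> {..n-r}"
      hence "r + s \<le> Suc n" using r by auto
      from choose_mult_choose_swap[OF this]
      show "bernoulli r * x ^ s * of_nat ((Suc n choose r) * (Suc n - r choose s)) = T r s"
        unfolding T_def by (simp only: of_nat_mult mult_ac)
    qed
    finally show "of_nat (Suc n choose r) * bernoulli r * ((x + 1) ^ (Suc n - r) - x ^ (Suc n - r)) =
      (\<Sum>s\<le>n-r. T r s)" .
  qed
  also have "\<dots> = (\<Sum>s\<le>n. \<Sum>r\<le>n-s. T r s)"
    by (subst (1 2) sum.Sigma)
      (auto intro!: sum.reindex_bij_witness[of _ "\<lambda>(s, r). (r, s)" "\<lambda>(r, s). (s, r)"])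
  also have "\<dots> = (\<Sum>s\<le>n. of_nat (Suc n choose s) * x ^ s * (if n - s = 0 then 1 else 0))"
    using sum_binomial_bernoulli
    by (intro sum.cong refl) (simp add: T_def Suc_diff_le flip: sum_distrib_left)
  also have "\<dots> = (\<Sum>s\<in>{n}. of_nat (Suc n choose s) * x ^ s * (if n - s = 0 then 1 else 0))"
    by (rule sum.mono_neutral_right) auto
  finally show ?thesis by simp
qed

lemma faulhaber:
  "of_nat (Suc n) * (\<Sum>j<k. of_nat j ^ n) =
     (\<Sum>r\<le>n. of_nat (Suc n choose r) * bernoulli r * of_nat k ^ (Suc n - r))"
proof (induction k)
  case 0
  have "(\<Sum>r\<le>n. of_nat (Suc n choose r) * bernoulli r * 0 ^ (Suc n - r)) = 0"
    by (intro sum.neutral) (auto simp: zero_power)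
  thus ?case by simp
next
  case (Suc k)
  show ?case
    using Suc faulhaber_step[of n "of_nat k"]
    by (simp add: algebra_simps sum_subtractf del: of_nat_Suc)
      (simp add: algebra_simps)
qed

text \<open>Abel summation: in \<open>A i * B i\<close> the pair \<open>(j, k)\<close> of indices occurs for all \<open>i\<close> from \<open>max j k\<close> to \<open>m\<close>,
  that is \<open>m + 1 - max j k\<close> times.\<close>

lemma sum_prefix_sums_mult:
  fixes f g :: "nat \<Rightarrow> rat"
  defines "A \<equiv> \<lambda>n. \<Sum>j=1..n. f j" and "B \<equiv> \<lambda>n. \<Sum>j=1..n. g j"
  shows "(\<Sum>i=1..m. A i * B i) = of_nat (Suc m) * (A m * B m) -
    (\<Sum>k=1..m. of_nat k * (A (k - 1) * g k + B (k - 1) * f k + f k * g k))"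
  by (induction m) (simp_all add: A_def B_def algebra_simps)

lemma sum_prefix_sums:
  fixes f :: "nat \<Rightarrow> rat"
  shows "(\<Sum>i=1..m. \<Sum>j=1..i. f j) = of_nat (Suc m) * (\<Sum>j=1..m. f j) - (\<Sum>k=1..m. of_nat k * f k)"
  by (induction m) (simp_all add: algebra_simps)

section \<open>Congruences between p-integral rationals\<close>

locale prime_modulus =
  fixes p :: nat
  assumes prime_p: "prime p"
begin

definition p_integral :: "rat \<Rightarrow> bool" where
  "p_integral x \<longleftrightarrow> (\<exists>m n :: int. \<not> int p dvd n \<and> x = of_int m / of_int n)"

abbreviation p_cong :: "rat \<Rightarrow> nat \<Rightarrow> rat \<Rightarrow> bool" ("(_ \<approx>\<^bsub>_\<^esub> _)" [51, 0, 51] 50) where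
  "x \<approx>\<^bsub>k\<^esub> y \<equiv> rat_cong p k x y"

lemma p_pos: "p > 0"
  using prime_p by (rule prime_gt_0_nat)

lemma not_dvd_mult: "\<not> int p dvd m \<Longrightarrow> \<not> int p dvd n \<Longrightarrow> \<not> int p dvd m * n"
  using prime_p by (simp add: prime_dvd_mult_iff)

lemma p_integralE:
  assumes "p_integral x"
  obtains m n where "\<not> int p dvd n" "n \<noteq> 0" "x = of_int m / of_int n"
  using assms unfolding p_integral_def by (metis dvd_0_right)

lemma p_integral_of_int [simp]: "p_integral (of_int m)"
  unfolding p_integral_def
  by (rule exI[of _ m], rule exI[of _ 1]) (use prime_gt_1_nat[OF prime_p] in auto)

lemma p_integral_of_nat [simp]: "p_integral (of_nat m)"
  using p_integral_of_int[of "int m"] by simp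

lemma p_integral_0 [simp]: "p_integral 0" and p_integral_1 [simp]: "p_integral 1"
  using p_integral_of_int[of 0] p_integral_of_int[of 1]
  by simp_all

lemma p_integral_add [simp]:
  assumes "p_integral x" "p_integral y" shows "p_integral (x + y)"
proof -
  obtain m n where "\<not> int p dvd n" "n \<noteq> 0" "x = of_int m / of_int n"
    using assms(1) by (rule p_integralE)
  moreover obtain r s where "\<not> int p dvd s" "s \<noteq> 0" "y = of_int r / of_int s"
    using assms(2) by (rule p_integralE)
  ultimately have "x + y = of_int (m * s + r * n) / of_int (n * s)"
    by (simp add: field_simps)
  thus ?thesis
    unfolding p_integral_def using \<open>\<not> int p dvd n\<close> \<open>\<not> int p dvd s\<close> not_dvd_mult by blast
qed

lemma p_integral_mult [simp]:
  assumes "p_integral x" "p_integral y" shows "p_integral (x * y)"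
proof -
  obtain m n where "\<not> int p dvd n" "n \<noteq> 0" "x = of_int m / of_int n"
    using assms(1) by (rule p_integralE)
  moreover obtain r s where "\<not> int p dvd s" "s \<noteq> 0" "y = of_int r / of_int s"
    using assms(2) by (rule p_integralE)
  ultimately have "x * y = of_int (m * r) / of_int (n * s)"
    by simp
  thus ?thesis
    unfolding p_integral_def using \<open>\<not> int p dvd n\<close> \<open>\<not> int p dvd s\<close> not_dvd_mult by blast
qed

lemma p_integral_uminus [simp]: "p_integral x \<Longrightarrow> p_integral (- x)"
  using p_integral_mult[OF p_integral_of_int[of "- 1"]] by simp

lemma p_integral_diff [simp]: "p_integral x \<Longrightarrow> p_integral y \<Longrightarrow> p_integral (x - y)"
  using p_integral_add[of x "- y"] by simp

lemma p_integral_power [simp]: "p_integral x \<Longrightarrow> p_integral (x ^ n)"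
  by (induction n) auto

lemma p_integral_sum [simp]: "(\<And>i. i \<in> A \<Longrightarrow> p_integral (f i)) \<Longrightarrow> p_integral (sum f A)"
  by (induction A rule: infinite_finite_induct) auto

text \<open>The form in which congruences are manipulated: no choice of fractions is left on the right. That
  the relation carries integrality of both sides makes it compatible with sums and products without
  side conditions.\<close>

lemma p_cong_iff: "x \<approx>\<^bsub>k\<^esub> y \<longleftrightarrow> p_integral y \<and> (\<exists>z. p_integral z \<and> x = y + of_nat p ^ k * z)"
proof
  assume "x \<approx>\<^bsub>k\<^esub> y"
  then obtain m n r s where *: "\<not> int p dvd n" "\<not> int p dvd s"
    "x = of_int m / of_int n" "y = of_int r / of_int s" "[m * s = n * r] (mod int p ^ k)"
    unfolding rat_cong_def by blast
  hence nz: "n \<noteq> 0" "s \<noteq> 0" by auto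
  obtain q where q: "m * s = n * r + int p ^ k * q"
    using * by (metis cong_iff_lin cong_sym)
  have "x - y = of_int (m * s - n * r) / of_int (n * s)"
    unfolding * using nz by (simp add: field_simps)
  also have "\<dots> = of_nat p ^ k * (of_int q / of_int (n * s))"
    using q by simp
  finally have "x = y + of_nat p ^ k * (of_int q / of_int (n * s))" by (simp add: algebra_simps)
  moreover have "p_integral (of_int q / of_int (n * s))"
    unfolding p_integral_def using * not_dvd_mult by blast
  moreover have "p_integral y"
    unfolding p_integral_def using * by blast
  ultimately show "p_integral y \<and> (\<exists>z. p_integral z \<and> x = y + of_nat p ^ k * z)" by blast
next
  assume "p_integral y \<and> (\<exists>z. p_integral z \<and> x = y + of_nat p ^ k * z)"
  then obtain r s q d z where *: "\<not> int p dvd s" "\<not> int p dvd d"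
    "y = of_int r / of_int s" "z = of_int q / of_int d" "x = y + of_nat p ^ k * z"
    unfolding p_integral_def by blast
  hence nz: "s \<noteq> 0" "d \<noteq> 0" by auto
  have "x = of_int (r * d + int p ^ k * q * s) / of_int (s * d)"
    using * nz by (simp add: field_simps)
  moreover have "[(r * d + int p ^ k * q * s) * s = (s * d) * r] (mod int p ^ k)"
    by (simp add: cong_iff_dvd_diff algebra_simps)
  ultimately show "x \<approx>\<^bsub>k\<^esub> y"
    unfolding rat_cong_def using * not_dvd_mult by blast
qed

lemma p_congI: "p_integral y \<Longrightarrow> p_integral z \<Longrightarrow> x = y + of_nat p ^ k * z \<Longrightarrow> x \<approx>\<^bsub>k\<^esub> y"
  unfolding p_cong_iff by blast

lemma p_cong_refl [simp]: "p_integral x \<Longrightarrow> x \<approx>\<^bsub>k\<^esub> x"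
  by (rule p_congI[of _ 0]) auto

lemma p_cong_integral_left: "x \<approx>\<^bsub>k\<^esub> y \<Longrightarrow> p_integral x"
  by (auto simp: p_cong_iff)

lemma p_cong_integral_right: "x \<approx>\<^bsub>k\<^esub> y \<Longrightarrow> p_integral y"
  by (auto simp: p_cong_iff)

lemma p_cong_sym: assumes "x \<approx>\<^bsub>k\<^esub> y" shows "y \<approx>\<^bsub>k\<^esub> x"
proof -
  obtain z where "p_integral z" "x = y + of_nat p ^ k * z" "p_integral y"
    using assms by (auto simp: p_cong_iff)
  thus ?thesis
    by (intro p_congI[of _ "- z"]) auto
qed

lemma p_cong_trans [trans]: assumes "x \<approx>\<^bsub>k\<^esub> y" "y \<approx>\<^bsub>k\<^esub> w" shows "x \<approx>\<^bsub>k\<^esub> w"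
proof -
  obtain z where z: "p_integral z" "x = y + of_nat p ^ k * z"
    using assms(1) by (auto simp: p_cong_iff)
  obtain z' where z': "p_integral z'" "y = w + of_nat p ^ k * z'" "p_integral w"
    using assms(2) by (auto simp: p_cong_iff)
  show ?thesis
    by (rule p_congI[of _ "z + z'"]) (use z z' in \<open>auto simp: algebra_simps\<close>)
qed

lemma p_cong_add: assumes "x \<approx>\<^bsub>k\<^esub> y" "x' \<approx>\<^bsub>k\<^esub> y'" shows "x + x' \<approx>\<^bsub>k\<^esub> y + y'"
proof -
  obtain z where z: "p_integral z" "x = y + of_nat p ^ k * z" "p_integral y"
    using assms(1) by (auto simp: p_cong_iff)
  obtain z' where z': "p_integral z'" "x' = y' + of_nat p ^ k * z'" "p_integral y'"
    using assms(2) by (auto simp: p_cong_iff)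
  show ?thesis
    by (rule p_congI[of _ "z + z'"]) (use z z' in \<open>auto simp: algebra_simps\<close>)
qed

lemma p_cong_mult: assumes "x \<approx>\<^bsub>k\<^esub> y" "x' \<approx>\<^bsub>k\<^esub> y'" shows "x * x' \<approx>\<^bsub>k\<^esub> y * y'"
proof -
  obtain z where z: "p_integral z" "x = y + of_nat p ^ k * z" "p_integral y"
    using assms(1) by (auto simp: p_cong_iff)
  obtain z' where z': "p_integral z'" "x' = y' + of_nat p ^ k * z'" "p_integral y'"
    using assms(2) by (auto simp: p_cong_iff)
  show ?thesis
    by (rule p_congI[of _ "z * y' + y * z' + of_nat p ^ k * z * z'"])
      (use z z' in \<open>auto simp: algebra_simps\<close>)
qed

lemma p_cong_scale: "p_integral c \<Longrightarrow> x \<approx>\<^bsub>k\<^esub> y \<Longrightarrow> c * x \<approx>\<^bsub>k\<^esub> c * y"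
  by (intro p_cong_mult p_cong_refl)

lemma p_cong_uminus: "x \<approx>\<^bsub>k\<^esub> y \<Longrightarrow> - x \<approx>\<^bsub>k\<^esub> - y"
  using p_cong_scale[of "- 1" k x y] by simp

lemma p_cong_diff: "x \<approx>\<^bsub>k\<^esub> y \<Longrightarrow> x' \<approx>\<^bsub>k\<^esub> y' \<Longrightarrow> x - x' \<approx>\<^bsub>k\<^esub> y - y'"
  using p_cong_add[of k x y "- x'" "- y'"] p_cong_uminus[of k x' y'] by simp

lemma p_cong_sum: "(\<And>i. i \<in> A \<Longrightarrow> f i \<approx>\<^bsub>k\<^esub> g i) \<Longrightarrow> sum f A \<approx>\<^bsub>k\<^esub> sum g A"
  by (induction A rule: infinite_finite_induct) (auto intro: p_cong_add)

lemma p_cong_prod: "(\<And>i. i \<in> A \<Longrightarrow> f i \<approx>\<^bsub>k\<^esub> g i) \<Longrightarrow> prod f A \<approx>\<^bsub>k\<^esub> prod g A"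
  by (induction A rule: infinite_finite_induct) (auto intro: p_cong_mult)

lemma p_cong_power: "x \<approx>\<^bsub>k\<^esub> y \<Longrightarrow> x ^ n \<approx>\<^bsub>k\<^esub> y ^ n"
  by (induction n) (auto intro: p_cong_mult)

lemma p_cong_of_int: "[m = n] (mod int p ^ k) \<Longrightarrow> of_int m \<approx>\<^bsub>k\<^esub> of_int n"
  unfolding rat_cong_def using prime_gt_1_nat[OF prime_p]
  by (intro exI[of _ m] exI[of _ 1] exI[of _ n]) auto

lemma p_cong_of_nat: "[m = n] (mod p ^ k) \<Longrightarrow> of_nat m \<approx>\<^bsub>k\<^esub> of_nat n"
  using p_cong_of_int[of "int m" "int n" k] cong_int_iff[of m n "p ^ k"] by simp

lemma p_cong_multiple: "p_integral z \<Longrightarrow> of_nat p ^ k * z \<approx>\<^bsub>k\<^esub> 0"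
  by (rule p_congI[of _ z]) auto

lemma p_cong_shift: "p_integral y \<Longrightarrow> p_integral z \<Longrightarrow> y + of_nat p * z \<approx>\<^bsub>1\<^esub> y"
  by (rule p_congI[of _ z]) auto

lemma p_cong_lift: assumes "x \<approx>\<^bsub>1\<^esub> y" shows "of_nat p * x \<approx>\<^bsub>2\<^esub> of_nat p * y"
proof -
  obtain z where "p_integral z" "x = y + of_nat p * z" "p_integral y"
    using assms by (auto simp: p_cong_iff)
  thus ?thesis
    by (intro p_congI[of _ z]) (auto simp: algebra_simps power2_eq_square)
qed

lemma p_cong_mult_0_0: assumes "x \<approx>\<^bsub>1\<^esub> 0" "y \<approx>\<^bsub>1\<^esub> 0" shows "x * y \<approx>\<^bsub>2\<^esub> 0"
proof -
  obtain z z' where "p_integral z" "x = of_nat p * z" "p_integral z'" "y = of_nat p * z'"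
    using assms by (auto simp: p_cong_iff)
  thus ?thesis
    by (intro p_congI[of _ "z * z'"]) (auto simp: algebra_simps power2_eq_square)
qed

text \<open>A factor divisible by \<open>p\<close> raises the precision: the other factor is needed only modulo \<open>p\<close>.\<close>

lemma p_cong_mult_0_cong: assumes "x \<approx>\<^bsub>1\<^esub> 0" "y \<approx>\<^bsub>1\<^esub> y'" shows "x * y \<approx>\<^bsub>2\<^esub> x * y'"
proof -
  have "x * (y - y') \<approx>\<^bsub>2\<^esub> 0"
    using assms p_cong_diff[OF assms(2) p_cong_refl[OF p_cong_integral_right[OF assms(2)]]]
    by (intro p_cong_mult_0_0) auto
  moreover have "p_integral (x * y')"
    using p_cong_integral_left[OF assms(1)] p_cong_integral_right[OF assms(2)] by simp
  ultimately have "x * (y - y') + x * y' \<approx>\<^bsub>2\<^esub> 0 + x * y'"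
    by (intro p_cong_add) auto
  thus ?thesis by (simp add: algebra_simps)
qed

definition p_unit :: "rat \<Rightarrow> bool" where
  "p_unit x \<longleftrightarrow> x \<noteq> 0 \<and> p_integral x \<and> p_integral (inverse x)"

lemma p_unit_nonzero: "p_unit x \<Longrightarrow> x \<noteq> 0"
  and p_unit_inverse [simp]: "p_unit x \<Longrightarrow> p_unit (inverse x)"
  by (auto simp: p_unit_def)

lemma p_unit_mult [simp]: "p_unit x \<Longrightarrow> p_unit y \<Longrightarrow> p_unit (x * y)"
  by (auto simp: p_unit_def)

lemma p_unit_1 [simp]: "p_unit 1"
  by (auto simp: p_unit_def)

lemma p_unit_uminus [simp]: "p_unit x \<Longrightarrow> p_unit (- x)"
  by (auto simp: p_unit_def)

lemma p_unit_of_int: assumes "\<not> int p dvd n" shows "p_unit (of_int n)"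
proof -
  have "inverse (of_int n :: rat) = of_int 1 / of_int n" by (simp add: divide_inverse)
  hence "p_integral (inverse (of_int n))" unfolding p_integral_def using assms by blast
  thus ?thesis using assms by (auto simp: p_unit_def)
qed

lemma p_unit_integral [simp]: "p_unit x \<Longrightarrow> p_integral x"
  by (simp add: p_unit_def)

lemma p_unit_power [simp]: "p_unit x \<Longrightarrow> p_unit (x ^ n)"
  by (induction n) auto

lemma p_unit_powi [simp]: "p_unit x \<Longrightarrow> p_unit (x powi e)"
  by (auto simp: power_int_def)

lemma p_integral_divide_unit: "p_integral x \<Longrightarrow> p_unit y \<Longrightarrow> p_integral (x / y)"
  by (simp add: divide_inverse)

lemma p_unit_of_nat: "\<not> p dvd n \<Longrightarrow> p_unit (of_nat n)"
  using p_unit_of_int[of "int n"] by simp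

lemma p_unit_of_nat_less: "0 < n \<Longrightarrow> n < p \<Longrightarrow> p_unit (of_nat n)"
  by (intro p_unit_of_nat) (auto dest: dvd_imp_le)

lemma p_unit_add_multiple:
  assumes "p_unit x" "p_integral z" shows "p_unit (x + of_nat p * z)"
proof -
  obtain m n where x: "\<not> int p dvd n" "n \<noteq> 0" "x = of_int m / of_int n"
    using assms(1) p_integralE unfolding p_unit_def by blast
  obtain m' n' where x': "\<not> int p dvd n'" "n' \<noteq> 0" "inverse x = of_int m' / of_int n'"
    using assms(1) p_integralE unfolding p_unit_def by blast
  have "\<not> int p dvd m"
  proof
    assume "int p dvd m"
    have "x * inverse x = 1" using assms(1) p_unit_nonzero by simp
    hence "of_int (m * m') = (of_int (n * n') :: rat)"
      unfolding x(3) x'(3)[unfolded x(3)] using x(2) x'(2) by (simp add: field_simps)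
    hence "m * m' = n * n'" by (simp only: of_int_eq_iff)
    thus False using \<open>int p dvd m\<close> not_dvd_mult[OF x(1) x'(1)] by (metis dvd_mult2)
  qed
  obtain q d where z: "\<not> int p dvd d" "d \<noteq> 0" "z = of_int q / of_int d"
    using assms(2) by (rule p_integralE)
  have "x + of_nat p * z = of_int (m * d + int p * (q * n)) * inverse (of_int (n * d))"
    using x z by (simp add: field_simps)
  moreover have "\<not> int p dvd m * d + int p * (q * n)"
    using not_dvd_mult[OF \<open>\<not> int p dvd m\<close> z(1)] by (simp add: dvd_add_left_iff)
  ultimately show ?thesis
    using p_unit_mult[OF p_unit_of_int p_unit_inverse[OF p_unit_of_int]] not_dvd_mult[OF x(1) z(1)]
    by metis
qed

lemma p_unit_cong: "x \<approx>\<^bsub>1\<^esub> y \<Longrightarrow> p_unit y \<Longrightarrow> p_unit x"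
  by (auto simp: p_cong_iff p_unit_add_multiple)

lemma p_cong_cancel: assumes "p_unit u" "u * x \<approx>\<^bsub>k\<^esub> u * y" shows "x \<approx>\<^bsub>k\<^esub> y"
proof -
  have "inverse u * (u * x) \<approx>\<^bsub>k\<^esub> inverse u * (u * y)"
    by (rule p_cong_scale) (use assms in auto)
  moreover have "inverse u * (u * w) = w" for w
    using p_unit_nonzero[OF assms(1)] by simp
  ultimately show ?thesis by simp
qed

lemma p_cong_weaken: assumes "x \<approx>\<^bsub>2\<^esub> y" shows "x \<approx>\<^bsub>1\<^esub> y"
proof -
  obtain z where "p_integral z" "x = y + of_nat p ^ 2 * z" "p_integral y"
    using assms by (auto simp: p_cong_iff)
  thus ?thesis
    by (intro p_congI[of _ "of_nat p * z"]) (auto simp: power2_eq_square)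
qed

lemma p_cong_inverse:
  assumes "x \<approx>\<^bsub>k\<^esub> y" "p_unit x" "p_unit y" shows "inverse x \<approx>\<^bsub>k\<^esub> inverse y"
proof (rule p_cong_cancel[of "x * y"])
  have "y \<approx>\<^bsub>k\<^esub> x" using assms(1) by (rule p_cong_sym)
  moreover have "x * y * inverse x = y" "x * y * inverse y = x"
    using assms(2,3)[THEN p_unit_nonzero] by auto
  ultimately show "x * y * inverse x \<approx>\<^bsub>k\<^esub> x * y * inverse y" by metis
qed (use assms in auto)

lemma p_cong_powi:
  assumes "x \<approx>\<^bsub>k\<^esub> y" "p_unit x" "p_unit y" shows "x powi e \<approx>\<^bsub>k\<^esub> y powi e"
  using assms by (auto simp: power_int_def intro!: p_cong_power p_cong_inverse)

lemma power_expand: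
  assumes "p_integral y" "p_integral z"
  shows "(y + of_nat p * z) ^ n \<approx>\<^bsub>2\<^esub> y ^ n + of_nat p * (of_nat n * z * y ^ (n - 1))"
proof (induction n)
  case (Suc n)
  have "(y + of_nat p * z) * (y + of_nat p * z) ^ n \<approx>\<^bsub>2\<^esub>
      (y + of_nat p * z) * (y ^ n + of_nat p * (of_nat n * z * y ^ (n - 1)))"
    using assms by (intro p_cong_scale Suc) auto
  also have "\<dots> \<approx>\<^bsub>2\<^esub> y ^ Suc n + of_nat p * (of_nat (Suc n) * z * y ^ n)"
  proof (rule p_congI[of _ "of_nat n * z * z * y ^ (n - 1)"])
    have step: "of_nat n * (y * y ^ (n - 1)) = of_nat n * y ^ n" by (cases n) auto
    have "(y + of_nat p * z) * (y ^ n + of_nat p * (of_nat n * z * t)) =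
      y ^ Suc n + of_nat p * z * (y ^ n + of_nat n * (y * t)) +
      of_nat p ^ 2 * (of_nat n * z * z * t)" for t
      by (simp add: algebra_simps power2_eq_square)
    from this[of "y ^ (n - 1)", unfolded step] show "(y + of_nat p * z) * (y ^ n + of_nat p * (of_nat n * z * y ^ (n - 1))) =
      y ^ Suc n + of_nat p * (of_nat (Suc n) * z * y ^ n) +
      of_nat p ^ 2 * (of_nat n * z * z * y ^ (n - 1))"
      by (simp add: algebra_simps power2_eq_square)
  qed (use assms in auto)
  finally show ?case by simp
qed (use assms in auto)

lemma inverse_expand:
  assumes "p_unit y" "p_integral z"
  shows "inverse (y + of_nat p * z) \<approx>\<^bsub>2\<^esub> inverse y + of_nat p * (- z * inverse y ^ 2)"
proof -
  have u: "p_unit (y + of_nat p * z)" using assms by (rule p_unit_add_multiple)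
  note nz = p_unit_nonzero[OF u] p_unit_nonzero[OF assms(1)]
  show ?thesis
  proof (rule p_congI[of _ "z ^ 2 * inverse y ^ 2 * inverse (y + of_nat p * z)"])
    define I where "I = inverse (y + of_nat p * z)"
    have "y * inverse y = 1" using nz by auto
    moreover have "(y + of_nat p * z) * I = 1" using nz by (simp add: I_def)
    moreover have "inverse y * ((y + of_nat p * z) * I) =
        (y * inverse y) * I + of_nat p * z * inverse y * I"
      by (simp only: algebra_simps)
    ultimately have step: "I = inverse y - of_nat p * z * inverse y * I"
      by simp
    have "I = inverse y - of_nat p * z * inverse y * (inverse y - of_nat p * z * inverse y * I)"
      by (subst step, subst step) (rule refl)
    thus "inverse (y + of_nat p * z) = inverse y + of_nat p * (- z * inverse y ^ 2) +
        of_nat p ^ 2 * (z ^ 2 * inverse y ^ 2 * inverse (y + of_nat p * z))"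
      unfolding I_def by (simp add: algebra_simps power2_eq_square)
  qed (use assms u in auto)
qed

text \<open>The first-order Taylor formula in \<open>p\<close>, for exponents of either sign. Negative exponents are the
  positive ones applied to the inverse, whose expansion is one step of the geometric series.\<close>

lemma powi_expand:
  assumes "p_unit y" "p_integral z"
  shows "(y + of_nat p * z) powi e \<approx>\<^bsub>2\<^esub> y powi e + of_nat p * (of_int e * z * y powi (e - 1))"
proof (cases "e > 0")
  case True
  define n where "n = nat (e - 1)"
  have "e = int (Suc n)" using True by (simp add: n_def)
  thus ?thesis
    using power_expand[of y z "Suc n"] assms by (simp add: power_int_def nat_add_distrib)
next
  case False
  define n where "n = nat (- e)"
  have e: "e = - int n" using False by (simp add: n_def)
  have "inverse (y + of_nat p * z) ^ n \<approx>\<^bsub>2\<^esub> (inverse y + of_nat p * (- z * inverse y ^ 2)) ^ n"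
    using assms by (intro p_cong_power inverse_expand)
  also have "\<dots> \<approx>\<^bsub>2\<^esub> inverse y ^ n +
      of_nat p * (of_nat n * (- z * inverse y ^ 2) * inverse y ^ (n - 1))"
    using assms by (intro power_expand) auto
  also have "of_nat n * (- z * inverse y ^ 2) * inverse y ^ (n - 1) =
      of_int e * z * y powi (e - 1)"
  proof (cases n)
    case (Suc m)
    have powi: "y powi (e - 1) = inverse y ^ (n + 1)"
      using e by (simp add: power_int_def nat_add_distrib)
    have "of_int e = (- of_nat n :: rat)" using e by simp
    show ?thesis unfolding powi \<open>of_int e = - of_nat n\<close>
      by (simp add: Suc power2_eq_square algebra_simps)
  qed (use e in auto)
  also have "inverse y ^ n = y powi e"
    using e by (simp add: power_int_minus power_inverse)
  also have "inverse (y + of_nat p * z) ^ n = (y + of_nat p * z) powi e"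
    using e by (simp add: power_int_minus power_inverse)
  finally show ?thesis .
qed

section \<open>Power sums modulo p and modulo the square of p\<close>

lemma fermat_powi:
  assumes "\<not> p dvd j" "[e = e'] (mod int (p - 1))"
  shows "of_nat j powi e \<approx>\<^bsub>1\<^esub> of_nat j powi e'"
proof -
  have u: "p_unit (of_nat j)" using assms(1) by (rule p_unit_of_nat)
  obtain q where q: "e = e' + int (p - 1) * q"
    using assms(2) by (metis cong_iff_lin cong_sym)
  have "of_nat (j ^ (p - 1)) \<approx>\<^bsub>1\<^esub> of_nat 1"
    using fermat_theorem[OF prime_p assms(1)] by (intro p_cong_of_nat) simp
  hence "(of_nat j ^ (p - 1)) powi q \<approx>\<^bsub>1\<^esub> 1 powi q"
    using u by (intro p_cong_powi) auto
  hence "of_nat j powi e' * (of_nat j ^ (p - 1)) powi q \<approx>\<^bsub>1\<^esub> of_nat j powi e' * 1"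
    using u by (intro p_cong_scale) auto
  thus ?thesis
    using p_unit_nonzero[OF u] by (simp add: q power_int_add power_int_mult)
qed

definition power_sum :: "int \<Rightarrow> rat" where
  "power_sum e = (\<Sum>j=1..p-1. of_nat j powi e)"

lemma unit_residue: "j \<in> {1..p-1} \<Longrightarrow> p_unit (of_nat j)"
  by (rule p_unit_of_nat_less) auto

lemma power_sum_integral [simp]: "p_integral (power_sum e)"
  unfolding power_sum_def by (intro p_integral_sum p_unit_integral p_unit_powi unit_residue)

lemma not_dvd_residue_mult: "\<not> p dvd c \<Longrightarrow> j \<in> {1..p-1} \<Longrightarrow> \<not> p dvd c * j"
  using prime_p by (auto simp: prime_dvd_mult_iff dest: dvd_imp_le)

lemma quotient_sum_integral:
  assumes "\<not> p dvd c"
  shows "p_integral (\<Sum>j=1..p-1. of_nat (c * j div p) * of_nat (c * j) powi e)"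
  using p_unit_of_nat[OF not_dvd_residue_mult[OF assms]]
  by (intro p_integral_sum p_integral_mult[OF p_integral_of_nat] p_unit_integral p_unit_powi)

lemma sum_residue_mult:
  assumes "\<not> p dvd c"
  shows "(\<Sum>j=1..p-1. f (c * j mod p)) = (\<Sum>j=1..p-1. f j)"
proof (rule sum.reindex_bij_betw)
  have cop: "coprime c p"
    using prime_imp_coprime[OF prime_p assms] by (simp add: coprime_commute)
  have inj: "inj_on (\<lambda>j. c * j mod p) {1..p-1}"
  proof (rule inj_onI)
    fix i j assume ij: "i \<in> {1..p-1}" "j \<in> {1..p-1}" "c * i mod p = c * j mod p"
    hence "[i = j] (mod p)"
      using cop by (simp add: cong_def[symmetric] cong_mult_lcancel_nat)
    thus "i = j" using ij(1,2) by (auto simp: cong_def)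
  qed
  have "(\<lambda>j. c * j mod p) ` {1..p-1} \<subseteq> {1..p-1}"
  proof
    fix i assume "i \<in> (\<lambda>j. c * j mod p) ` {1..p-1}"
    then obtain j where j: "j \<in> {1..p-1}" "i = c * j mod p" by blast
    have "\<not> p dvd c * j"
      using assms j(1) by (rule not_dvd_residue_mult)
    hence "i > 0" using j by (auto simp: dvd_eq_mod_eq_0)
    moreover have "i < p" using j p_pos by simp
    ultimately show "i \<in> {1..p-1}" by auto
  qed
  with inj show "bij_betw (\<lambda>j. c * j mod p) {1..p-1} {1..p-1}"
    unfolding bij_betw_def by (intro conjI endo_inj_surj) auto
qed

text \<open>Multiplication by \<open>c\<close> permutes the nonzero residues. Replacing each residue \<open>c * j mod p\<close> by
  \<open>c * j - p * (c * j div p)\<close> and expanding to first order in \<open>p\<close> gives a congruence modulo \<open>p\<^sup>2\<close> in the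
  spirit of Voronoi.\<close>

lemma power_sum_dilate:
  assumes "\<not> p dvd c"
  shows "power_sum e \<approx>\<^bsub>2\<^esub> of_nat c powi e * power_sum e -
    of_nat p * (of_int e * (\<Sum>j=1..p-1. of_nat (c * j div p) * of_nat (c * j) powi (e - 1)))"
proof -
  have "(\<Sum>j=1..p-1. of_nat (c * j mod p) powi e) \<approx>\<^bsub>2\<^esub>
     (\<Sum>j=1..p-1. of_nat (c * j) powi e +
        of_nat p * (of_int e * (- of_nat (c * j div p)) * of_nat (c * j) powi (e - 1)))"
  proof (rule p_cong_sum)
    fix j assume j: "j \<in> {1..p-1}"
    have "\<not> p dvd c * j"
      using assms j by (rule not_dvd_residue_mult)
    hence "p_unit (of_nat (c * j))" by (rule p_unit_of_nat)
    moreover have "of_nat (c * j mod p) = (of_nat (c * j) + of_nat p * (- of_nat (c * j div p)) :: rat)"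
    proof -
      have "(of_nat (c * j) :: rat) = of_nat (p * (c * j div p) + c * j mod p)" by simp
      thus ?thesis by (simp only: of_nat_add of_nat_mult)
    qed
    ultimately show "of_nat (c * j mod p) powi e \<approx>\<^bsub>2\<^esub> of_nat (c * j) powi e +
        of_nat p * (of_int e * (- of_nat (c * j div p)) * of_nat (c * j) powi (e - 1))"
      using powi_expand[of "of_nat (c * j)" "- of_nat (c * j div p)" e] by simp
  qed
  also have "(\<Sum>j=1..p-1. of_nat (c * j mod p) powi e) = power_sum e"
    unfolding power_sum_def by (rule sum_residue_mult[OF assms])
  also have "(\<Sum>j=1..p-1. of_nat (c * j) powi e +
        of_nat p * (of_int e * (- of_nat (c * j div p)) * of_nat (c * j) powi (e - 1))) =
      of_nat c powi e * power_sum e -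
    of_nat p * (of_int e * (\<Sum>j=1..p-1. of_nat (c * j div p) * of_nat (c * j) powi (e - 1)))"
    by (simp add: power_sum_def sum_subtractf sum_distrib_left power_int_mult_distrib
        mult.assoc mult.left_commute)
  finally show ?thesis .
qed

text \<open>A primitive root serves as \<open>c\<close>: its powers with exponent not divisible by \<open>p - 1\<close> differ from \<open>1\<close>
  modulo \<open>p\<close>.\<close>

lemma exists_noninvariant_dilation:
  assumes "\<not> int (p - 1) dvd e"
  obtains c where "\<not> p dvd c" "p_unit (1 - of_nat c powi e)"
proof -
  obtain c where c: "residue_primroot p c"
    using prime_primitive_root_exists[OF prime_gt_1_nat[OF prime_p]] prime_p by auto
  hence ord: "ord p c = p - 1" and cop: "coprime p c"
    by (auto simp: residue_primroot_def totient_prime[OF prime_p])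
  have ndvd: "\<not> p dvd c"
    using cop prime_gt_1_nat[OF prime_p] by (auto simp: coprime_absorb_left)
  define m where "m = nat (e mod int (p - 1))"
  have p1: "p - 1 > 0" using prime_gt_1_nat[OF prime_p] by simp
  have m: "int m = e mod int (p - 1)" using p1 by (simp add: m_def)
  have "\<not> p - 1 dvd m"
    using assms by (simp add: m dvd_mod_iff flip: int_dvd_int_iff)
  hence "\<not> [c ^ m = 1] (mod p)"
    using ord ord_divides[of c m p] by simp
  hence "\<not> [int (c ^ m) = int 1] (mod int p)"
    by (simp only: cong_int_iff not_False_eq_True)
  hence "\<not> int p dvd (1 - int (c ^ m))"
    by (simp add: cong_iff_dvd_diff dvd_diff_commute)
  hence "p_unit (of_int (1 - int (c ^ m)))" by (rule p_unit_of_int)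
  moreover have "of_nat c powi e \<approx>\<^bsub>1\<^esub> of_nat c powi int m"
    using m by (intro fermat_powi ndvd) (simp add: cong_def)
  hence "1 - of_nat c powi e \<approx>\<^bsub>1\<^esub> of_int (1 - int (c ^ m))"
    by (auto intro: p_cong_diff)
  ultimately have "p_unit (1 - of_nat c powi e)" using p_unit_cong by blast
  with ndvd show ?thesis by (rule that)
qed

lemma power_sum_cong_0:
  assumes "\<not> int (p - 1) dvd e"
  shows "power_sum e \<approx>\<^bsub>1\<^esub> 0"
proof -
  obtain c where c: "\<not> p dvd c" "p_unit (1 - of_nat c powi e)"
    using exists_noninvariant_dilation[OF assms] .
  define X where "X = (\<Sum>j=1..p-1. of_nat (c * j div p) * of_nat (c * j) powi (e - 1) :: rat)"
  have cu: "p_unit (of_nat c)" using c(1) by (rule p_unit_of_nat)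
  have "p_integral X" unfolding X_def
    using c(1) by (rule quotient_sum_integral)
  hence X: "of_nat p ^ 1 * (of_int e * X) \<approx>\<^bsub>1\<^esub> 0"
    by (intro p_cong_multiple) auto
  have "power_sum e - of_nat c powi e * power_sum e \<approx>\<^bsub>1\<^esub>
      (of_nat c powi e * power_sum e - of_nat p * (of_int e * X)) - of_nat c powi e * power_sum e"
    unfolding X_def
    by (rule p_cong_diff[OF p_cong_weaken[OF power_sum_dilate[OF c(1)]] p_cong_refl])
      (rule p_integral_mult[OF p_unit_integral[OF p_unit_powi[OF cu]] power_sum_integral])
  also have "\<dots> = - (of_nat p ^ 1 * (of_int e * X))" by simp
  also have "\<dots> \<approx>\<^bsub>1\<^esub> - 0" by (rule p_cong_uminus[OF X])
  finally have "(1 - of_nat c powi e) * power_sum e \<approx>\<^bsub>1\<^esub> (1 - of_nat c powi e) * 0"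
    by (simp add: algebra_simps)
  thus ?thesis by (rule p_cong_cancel[OF c(2)])
qed

text \<open>A Kummer congruence for power sums. In the dilation formula for \<open>e\<close> and for \<open>e'\<close>, the sums over the
  quotients \<open>c * j div p\<close> agree modulo \<open>p\<close>, by Fermat's theorem, and they carry a factor \<open>p\<close>; so the
  two power sums, divided by their exponents, agree modulo \<open>p\<^sup>2\<close>. Stated without division, since an
  exponent may be divisible by \<open>p\<close>.\<close>

lemma power_sum_kummer:
  assumes "\<not> int (p - 1) dvd e" "[e = e'] (mod int (p - 1))"
  shows "of_int e' * power_sum e \<approx>\<^bsub>2\<^esub> of_int e * power_sum e'"
proof -
  obtain c where c: "\<not> p dvd c" "p_unit (1 - of_nat c powi e)"
    using exists_noninvariant_dilation[OF assms(1)] .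
  have cu: "p_unit (of_nat c)" using c(1) by (rule p_unit_of_nat)
  define X where "X e = (\<Sum>j=1..p-1. of_nat (c * j div p) * of_nat (c * j) powi (e - 1) :: rat)" for e
  have X_int: "p_integral (X e)" for e unfolding X_def
    using c(1) by (rule quotient_sum_integral)
  have dil: "(1 - of_nat c powi e) * power_sum e \<approx>\<^bsub>2\<^esub> of_int e * - (of_nat p * X e)" for e
  proof -
    have "power_sum e - of_nat c powi e * power_sum e \<approx>\<^bsub>2\<^esub>
      (of_nat c powi e * power_sum e - of_nat p * (of_int e * X e)) - of_nat c powi e * power_sum e"
      unfolding X_def
      by (rule p_cong_diff[OF power_sum_dilate[OF c(1)] p_cong_refl])
        (rule p_integral_mult[OF p_unit_integral[OF p_unit_powi[OF cu]] power_sum_integral])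
    thus ?thesis by (simp add: algebra_simps)
  qed
  have X_cong: "X e \<approx>\<^bsub>1\<^esub> X e'"
    unfolding X_def
  proof (intro p_cong_sum p_cong_scale[OF p_integral_of_nat] fermat_powi)
    show "\<not> p dvd c * j" if "j \<in> {1..p-1}" for j
      using c(1) that by (rule not_dvd_residue_mult)
  qed (use assms(2) in \<open>auto intro: cong_diff\<close>)
  have "\<not> int (p - 1) dvd e'" using assms by (simp add: cong_dvd_iff)
  hence P': "power_sum e' \<approx>\<^bsub>1\<^esub> 0" by (rule power_sum_cong_0)
  have "1 - of_nat c powi e' \<approx>\<^bsub>1\<^esub> 1 - of_nat c powi e"
    using assms(2) c(1) by (intro p_cong_diff fermat_powi) (auto simp: cong_sym)
  hence switch: "power_sum e' * (1 - of_nat c powi e') \<approx>\<^bsub>2\<^esub> power_sum e' * (1 - of_nat c powi e)"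
    by (intro p_cong_mult_0_cong P')
  have "of_int e' * ((1 - of_nat c powi e) * power_sum e) \<approx>\<^bsub>2\<^esub>
      of_int e' * (of_int e * - (of_nat p * X e))"
    by (rule p_cong_scale[OF _ dil]) auto
  also have "\<dots> = of_int e' * of_int e * - (of_nat p * X e)" by simp
  also have "\<dots> \<approx>\<^bsub>2\<^esub> of_int e' * of_int e * - (of_nat p * X e')"
    by (rule p_cong_scale[OF _ p_cong_uminus[OF p_cong_lift[OF X_cong]]]) auto
  also have "\<dots> = of_int e * (of_int e' * - (of_nat p * X e'))" by simp
  also have "\<dots> \<approx>\<^bsub>2\<^esub> of_int e * (power_sum e' * (1 - of_nat c powi e'))"
    by (rule p_cong_scale[OF _ p_cong_sym[OF dil[of e', unfolded mult.commute[of "1 - _"]]]]) auto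
  also have "\<dots> \<approx>\<^bsub>2\<^esub> of_int e * (power_sum e' * (1 - of_nat c powi e))"
    by (rule p_cong_scale[OF _ switch]) auto
  finally have "(1 - of_nat c powi e) * (of_int e' * power_sum e) \<approx>\<^bsub>2\<^esub>
     (1 - of_nat c powi e) * (of_int e * power_sum e')"
    by (simp add: mult_ac)
  thus ?thesis by (rule p_cong_cancel[OF c(2)])
qed

section \<open>Bernoulli numbers in power sums\<close>

text \<open>The elementary part of the von Staudt-Clausen theorem: the recursion divides only by numbers below
  \<open>p\<close>.\<close>

lemma bernoulli_integral: "r + 1 < p \<Longrightarrow> p_integral (bernoulli r)"
proof (induction r rule: less_induct)
  case (less r)
  show ?case
  proof (cases r)
    case (Suc n)
    have "p_integral (\<Sum>k\<le>n. of_nat ((n + 2) choose k) * bernoulli k)"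
      using less Suc by (intro p_integral_sum p_integral_mult p_integral_of_nat) auto
    moreover have "p_unit (of_nat (n + 2))"
      using less Suc by (intro p_unit_of_nat_less) auto
    ultimately show ?thesis
      unfolding Suc bernoulli.simps(2) by (intro p_integral_divide_unit p_integral_uminus)
  qed simp
qed

text \<open>Faulhaber's formula at \<open>k = p\<close>: every term other than the one linear in \<open>p\<close> is divisible by \<open>p\<^sup>2\<close>.\<close>

lemma power_sum_eq_p_bernoulli:
  assumes "0 < n" "n + 1 < p"
  shows "power_sum (int n) \<approx>\<^bsub>2\<^esub> of_nat p * bernoulli n"
proof -
  have "(\<Sum>j<p. of_nat j ^ n :: rat) = (\<Sum>j\<in>{1..p-1}. of_nat j ^ n)"
    using assms by (intro sum.mono_neutral_right) (auto simp: not_le less_Suc_eq_0_disj zero_power)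
  hence P: "(\<Sum>j<p. of_nat j ^ n) = power_sum (int n)" by (simp add: power_sum_def)
  have split: "of_nat (Suc n) * power_sum (int n) =
      (\<Sum>r<n. of_nat (Suc n choose r) * bernoulli r * of_nat p ^ (Suc n - r)) +
      of_nat (Suc n) * (of_nat p * bernoulli n)"
    using faulhaber[of n p] unfolding P lessThan_Suc_atMost[symmetric] by simp
  have "(\<Sum>r<n. of_nat (Suc n choose r) * bernoulli r * of_nat p ^ (Suc n - r)) \<approx>\<^bsub>2\<^esub> (\<Sum>r<n. 0)"
  proof (rule p_cong_sum)
    fix r assume r: "r \<in> {..<n}"
    hence "Suc n - r = 2 + (n - r - 1)" by auto
    hence "of_nat p ^ (Suc n - r) = (of_nat p ^ 2 * of_nat p ^ (n - r - 1) :: rat)"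
      by (simp only: power_add)
    hence "of_nat (Suc n choose r) * bernoulli r * of_nat p ^ (Suc n - r) =
       of_nat p ^ 2 * (of_nat (Suc n choose r) * bernoulli r * of_nat p ^ (n - r - 1))"
      by simp
    moreover have "p_integral (bernoulli r)" using r assms by (intro bernoulli_integral) auto
    ultimately show "of_nat (Suc n choose r) * bernoulli r * of_nat p ^ (Suc n - r) \<approx>\<^bsub>2\<^esub> 0"
      by (simp only:) (intro p_cong_multiple p_integral_mult p_integral_power p_integral_of_nat)
  qed
  hence "of_nat (Suc n) * power_sum (int n) \<approx>\<^bsub>2\<^esub> (\<Sum>r<n. 0) + of_nat (Suc n) * (of_nat p * bernoulli n)"
    unfolding split by (rule p_cong_add)
      (intro p_cong_refl p_integral_mult p_integral_of_nat bernoulli_integral assms)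
  moreover have "p_unit (of_nat (Suc n))"
    using assms by (intro p_unit_of_nat_less) auto
  ultimately show ?thesis by (simp only: add_0 sum.neutral_const) (rule p_cong_cancel)
qed

lemma p_minus_1_not_dvd: "0 < m \<Longrightarrow> m < p - 1 \<Longrightarrow> \<not> int (p - 1) dvd - int m"
  by (simp only: dvd_minus_iff int_dvd_int_iff) (auto dest: dvd_imp_le)

text \<open>The negative exponent \<open>- a\<close> is compared with the positive exponent \<open>p - 1 - a\<close>. As the power sums
  are divisible by \<open>p\<close>, the factor \<open>p - 1 - a\<close> may be replaced by \<open>- (a + 1)\<close>.\<close>

lemma power_sum_negative:
  assumes "0 < a" "a + 2 < p"
  shows "of_nat (a + 1) * power_sum (- int a) \<approx>\<^bsub>2\<^esub> of_nat a * (of_nat p * bernoulli (p - 1 - a))"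
proof -
  define n where "n = p - 1 - a"
  have n: "0 < n" "n + 1 < p" "int n = int p - 1 - int a"
    using assms by (auto simp: n_def)
  have nd: "\<not> int (p - 1) dvd - int a"
    using assms by (intro p_minus_1_not_dvd) auto
  have "[- int a = int n] (mod int (p - 1))"
  proof -
    have "- int a - int n = - int (p - 1)" using assms by (simp add: n)
    thus ?thesis by (simp only: cong_iff_dvd_diff dvd_minus_iff dvd_refl)
  qed
  from power_sum_kummer[OF nd this]
  have K: "of_int (int n) * power_sum (- int a) \<approx>\<^bsub>2\<^esub> of_int (- int a) * power_sum (int n)" .
  have "of_nat p * power_sum (- int a) \<approx>\<^bsub>2\<^esub> of_nat p * 0"
    by (rule p_cong_lift[OF power_sum_cong_0[OF nd]])
  hence "of_nat p * power_sum (- int a) - of_int (int n) * power_sum (- int a) \<approx>\<^bsub>2\<^esub>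
      of_nat p * 0 - of_int (- int a) * power_sum (int n)"
    using K by (rule p_cong_diff)
  also have "of_nat p * power_sum (- int a) - of_int (int n) * power_sum (- int a) =
      of_nat (a + 1) * power_sum (- int a)"
    unfolding n by (simp add: algebra_simps)
  also have "of_nat p * 0 - of_int (- int a) * power_sum (int n) = of_nat a * power_sum (int n)"
    by simp
  also have "\<dots> \<approx>\<^bsub>2\<^esub> of_nat a * (of_nat p * bernoulli n)"
    by (rule p_cong_scale[OF p_integral_of_nat power_sum_eq_p_bernoulli[OF n(1,2)]])
  finally show ?thesis by (simp add: n_def)
qed

section \<open>Nested sums and products of harmonic numbers modulo p\<close>

lemma power_sum_cong_minus_1:
  assumes "int (p - 1) dvd e"
  shows "power_sum e \<approx>\<^bsub>1\<^esub> - 1"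
proof -
  have "power_sum e \<approx>\<^bsub>1\<^esub> (\<Sum>j=1..p-1. of_nat j powi 0)"
    unfolding power_sum_def
  proof (intro p_cong_sum fermat_powi)
    show "\<not> p dvd j" if "j \<in> {1..p-1}" for j using that by (auto dest: dvd_imp_le)
    show "[e = 0] (mod int (p - 1))" using assms by (simp add: cong_iff_dvd_diff)
  qed
  also have "(\<Sum>j=1..p-1. of_nat j powi 0) = (of_nat (p - 1) :: rat)" by simp
  also have "\<dots> = - 1 + of_nat p * 1" using p_pos by simp
  also have "\<dots> \<approx>\<^bsub>1\<^esub> - 1" by (rule p_cong_shift) auto
  finally show ?thesis .
qed

text \<open>Modulo \<open>p\<close> the upper index \<open>p - x\<close> may be read as \<open>- x\<close>, and the sign of an upper index can be
  reversed.\<close>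

lemma choose_p_minus_cong:
  assumes "0 < x" "x \<le> p" "t < p"
  shows "of_nat (p - x choose t) \<approx>\<^bsub>1\<^esub> (- 1) ^ t * of_nat (x + t - 1 choose t)"
proof -
  have "fact t * (of_nat (p - x) gchoose t) = (\<Prod>i=0..<t. of_nat (p - x) - of_nat i :: rat)"
    by (simp only: gbinomial_mult_fact)
  also have "\<dots> = (\<Prod>i=0..<t. (- of_nat x - of_nat i) + of_nat p * 1)"
    using assms by (intro prod.cong) auto
  also have "\<dots> \<approx>\<^bsub>1\<^esub> (\<Prod>i=0..<t. - of_nat x - of_nat i)"
    by (intro p_cong_prod p_cong_shift) auto
  also have "\<dots> = fact t * ((- of_nat x) gchoose t)"
    by (simp only: gbinomial_mult_fact)
  also have "((- of_nat x) gchoose t) = (- 1) ^ t * (of_nat (x + t - 1) gchoose t :: rat)"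
    using assms by (subst gbinomial_minus) simp
  finally have "fact t * of_nat (p - x choose t) \<approx>\<^bsub>1\<^esub>
      fact t * ((- 1) ^ t * of_nat (x + t - 1 choose t))"
    by (simp only: binomial_gbinomial)
  moreover have "p_unit (fact t)"
    using p_unit_of_nat[of "fact t"] prime_dvd_fact_iff[OF prime_p] assms by simp
  ultimately show ?thesis by (rule p_cong_cancel[rotated])
qed

text \<open>The multiple harmonic sum of \<open>j powi (- x) * k powi (- t)\<close> over \<open>0 < j < k < p\<close>.\<close>

definition nested_sum :: "nat \<Rightarrow> nat \<Rightarrow> rat" where
  "nested_sum x t = (\<Sum>k=1..p-1. of_nat k powi (- int t) * gen_harmonic (int x) (k - 1))"

lemma gen_harmonic_integral [simp]: "n < p \<Longrightarrow> p_integral (gen_harmonic r n)"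
  unfolding gen_harmonic_def
  by (intro p_integral_sum p_unit_integral p_unit_powi p_unit_of_nat_less) auto

lemma nested_sum_integral [simp]: "p_integral (nested_sum x t)"
  unfolding nested_sum_def
proof (intro p_integral_sum p_integral_mult)
  show "p_integral (of_nat k powi (- int t))" if "k \<in> {1..p-1}" for k
    using unit_residue[OF that] by (intro p_unit_integral p_unit_powi)
qed (auto intro!: gen_harmonic_integral)

text \<open>Replacing \<open>- x\<close> by \<open>n = p - 1 - x\<close> and \<open>- t\<close> by \<open>u = p - 1 - t\<close> makes all exponents nonnegative, so that
  Faulhaber's formula evaluates the inner sum. What is left of the sum over \<open>k\<close> are power sums with
  exponents \<open>2 * p - 1 - t - x - r\<close>.\<close>

lemma nested_sum_bernoulli:
  assumes "0 < x" "x + 1 < p" "t < p"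
  shows "of_nat (p - x) * nested_sum x t \<approx>\<^bsub>1\<^esub>
    (\<Sum>r\<le>p-1-x. of_nat (p - x choose r) * bernoulli r *
       (if p - 1 dvd 2 * p - 1 - t - x - r then - 1 else 0))"
proof -
  define n where "n = p - 1 - x"
  define u where "u = p - 1 - t"
  have n: "0 < n" "Suc n = p - x" "n + 1 < p" using assms by (auto simp: n_def)
  have ndvd: "\<not> p dvd k" if "k \<in> {1..p-1}" for k using that by (auto dest: dvd_imp_le)
  have "nested_sum x t \<approx>\<^bsub>1\<^esub> (\<Sum>k=1..p-1. of_nat k powi int u * (\<Sum>j=1..k-1. of_nat j powi int n))"
    unfolding nested_sum_def gen_harmonic_def
  proof (intro p_cong_sum p_cong_mult fermat_powi)
    fix k assume k: "k \<in> {1..p-1}"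
    show "\<not> p dvd k" using k by (rule ndvd)
    show "\<not> p dvd j" if "j \<in> {1..k-1}" for j using k that by (intro ndvd) auto
    have "- int t - int u = - int (p - 1)" using assms by (simp add: u_def)
    thus "[- int t = int u] (mod int (p - 1))"
      by (simp only: cong_iff_dvd_diff dvd_minus_iff dvd_refl)
    have "- int x - int n = - int (p - 1)" using assms by (simp add: n_def)
    thus "[- int x = int n] (mod int (p - 1))"
      by (simp only: cong_iff_dvd_diff dvd_minus_iff dvd_refl)
  qed
  hence "of_nat (Suc n) * nested_sum x t \<approx>\<^bsub>1\<^esub>
      of_nat (Suc n) * (\<Sum>k=1..p-1. of_nat k powi int u * (\<Sum>j=1..k-1. of_nat j powi int n))"
    by (rule p_cong_scale[OF p_integral_of_nat])
  also have "\<dots> = (\<Sum>k=1..p-1. \<Sum>r\<le>n. of_nat (Suc n choose r) * bernoulli r * of_nat k powi int (u + (Suc n - r)))"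
    unfolding sum_distrib_left
  proof (rule sum.cong[OF refl])
    fix k assume k: "k \<in> {1..p-1}"
    have "(\<Sum>j<k. of_nat j ^ n :: rat) = (\<Sum>j=1..k-1. of_nat j ^ n)"
      using k n by (intro sum.mono_neutral_right) (auto simp: not_le less_Suc_eq_0_disj zero_power)
    hence "of_nat (Suc n) * (of_nat k powi int u * (\<Sum>j=1..k-1. of_nat j powi int n)) =
      of_nat k ^ u * (of_nat (Suc n) * (\<Sum>j<k. of_nat j ^ n) :: rat)"
      by (simp only: power_int_of_nat mult_ac)
    also have "\<dots> = (\<Sum>r\<le>n. of_nat (Suc n choose r) * bernoulli r * of_nat k powi int (u + (Suc n - r)))"
      unfolding faulhaber unfolding sum_distrib_left
      by (intro sum.cong refl) (simp only: power_int_of_nat power_add mult_ac)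
    finally show "(\<Sum>j=1..k-1. of_nat (Suc n) * (of_nat k powi int u * of_nat j powi int n)) =
       (\<Sum>r\<le>n. of_nat (Suc n choose r) * bernoulli r * of_nat k powi int (u + (Suc n - r)))"
      by (simp only: sum_distrib_left)
  qed
  also have "\<dots> = (\<Sum>r\<le>n. of_nat (Suc n choose r) * bernoulli r * power_sum (int (u + (Suc n - r))))"
    unfolding power_sum_def sum_distrib_left by (rule sum.swap)
  also have "\<dots> \<approx>\<^bsub>1\<^esub> (\<Sum>r\<le>n. of_nat (Suc n choose r) * bernoulli r *
      (if p - 1 dvd 2 * p - 1 - t - x - r then - 1 else 0))"
  proof (rule p_cong_sum)
    fix r assume r: "r \<in> {..n}"
    have e: "u + (Suc n - r) = 2 * p - 1 - t - x - r"
      using r assms by (auto simp: u_def n_def)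
    have "p_integral (bernoulli r)" using r n by (intro bernoulli_integral) auto
    moreover have "power_sum (int (u + (Suc n - r))) \<approx>\<^bsub>1\<^esub>
        (if p - 1 dvd 2 * p - 1 - t - x - r then - 1 else 0)"
      unfolding e using power_sum_cong_0 power_sum_cong_minus_1 by simp
    ultimately show "of_nat (Suc n choose r) * bernoulli r * power_sum (int (u + (Suc n - r))) \<approx>\<^bsub>1\<^esub>
       of_nat (Suc n choose r) * bernoulli r * (if p - 1 dvd 2 * p - 1 - t - x - r then - 1 else 0)"
      by (intro p_cong_scale[OF p_integral_mult[OF p_integral_of_nat]])
  qed
  finally show ?thesis unfolding n(2) unfolding n_def .
qed

lemma dvd_between_unique:
  fixes d e :: nat
  assumes "0 < e" "e < 2 * d"
  shows "d dvd e \<longleftrightarrow> e = d"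
proof
  assume "d dvd e"
  then obtain q where q: "e = d * q" ..
  hence "d * q < d * 2" "q \<noteq> 0" using assms by auto
  hence "q = 1" by (simp only: mult_less_cancel1) linarith
  thus "e = d" using q by simp
qed auto

text \<open>For \<open>t = 0\<close> the only exponent divisible by \<open>p - 1\<close> would belong to \<open>r = p - x\<close>, just outside the range
  of Faulhaber's formula.\<close>

lemma nested_sum_cong_0:
  assumes "2 \<le> x" "x + 1 < p"
  shows "nested_sum x 0 \<approx>\<^bsub>1\<^esub> 0"
proof -
  have unit: "p_unit (of_nat (p - x))" using assms by (intro p_unit_of_nat_less) auto
  have "of_nat (p - x) * nested_sum x 0 \<approx>\<^bsub>1\<^esub>
    (\<Sum>r\<le>p-1-x. of_nat (p - x choose r) * bernoulli r *
       (if p - 1 dvd 2 * p - 1 - 0 - x - r then - 1 else 0))"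
    using assms by (intro nested_sum_bernoulli) auto
  also have "\<dots> = 0"
  proof (rule sum.neutral, rule ballI)
    fix r assume r: "r \<in> {..p-1-x}"
    have "\<not> p - 1 dvd 2 * p - 1 - 0 - x - r"
      using assms r by (subst dvd_between_unique) auto
    thus "of_nat (p - x choose r) * bernoulli r *
       (if p - 1 dvd 2 * p - 1 - 0 - x - r then - 1 else 0) = 0" by simp
  qed
  finally have "of_nat (p - x) * nested_sum x 0 \<approx>\<^bsub>1\<^esub> of_nat (p - x) * 0"
    by (simp only: mult_zero_right)
  with unit show ?thesis by (rule p_cong_cancel)
qed

text \<open>Only the term with exponent \<open>p - 1\<close>, that is \<open>r = p - x - t\<close>, survives.\<close>

lemma nested_sum_cong:
  assumes "0 < x" "0 < t" "x + t < p"
  shows "of_nat (x + t) * nested_sum x t \<approx>\<^bsub>1\<^esub>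
    (- 1) ^ t * of_nat (x + t choose t) * bernoulli (p - x - t)"
proof -
  have B: "p_integral (bernoulli (p - x - t))"
    using assms by (intro bernoulli_integral) auto
  have "of_nat (p - x) * nested_sum x t \<approx>\<^bsub>1\<^esub>
    (\<Sum>r\<le>p-1-x. of_nat (p - x choose r) * bernoulli r *
       (if p - 1 dvd 2 * p - 1 - t - x - r then - 1 else 0))"
    using assms by (intro nested_sum_bernoulli) auto
  also have "\<dots> = (\<Sum>r\<le>p-1-x. if r = p - x - t then - (of_nat (p - x choose r) * bernoulli r) else 0)"
  proof (rule sum.cong[OF refl])
    fix r assume r: "r \<in> {..p-1-x}"
    have "p - 1 dvd 2 * p - 1 - t - x - r \<longleftrightarrow> r = p - x - t"
      using assms r by (subst dvd_between_unique) auto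
    thus "of_nat (p - x choose r) * bernoulli r * (if p - 1 dvd 2 * p - 1 - t - x - r then - 1 else 0) =
      (if r = p - x - t then - (of_nat (p - x choose r) * bernoulli r) else 0)" by simp
  qed
  also have "\<dots> = - (of_nat (p - x choose (p - x - t)) * bernoulli (p - x - t))"
    using assms by simp
  also have "(p - x choose (p - x - t)) = (p - x choose t)"
    using assms binomial_symmetric[of t "p - x"] by simp
  also have "- (of_nat (p - x choose t) * bernoulli (p - x - t)) \<approx>\<^bsub>1\<^esub>
     - ((- 1) ^ t * of_nat (x + t - 1 choose t) * bernoulli (p - x - t))"
    using assms by (intro p_cong_uminus p_cong_mult[OF choose_p_minus_cong p_cong_refl] B) auto
  finally have "of_nat (p - x) * nested_sum x t - of_nat p * nested_sum x t \<approx>\<^bsub>1\<^esub>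
     - ((- 1) ^ t * of_nat (x + t - 1 choose t) * bernoulli (p - x - t)) - 0"
    using p_cong_multiple[of "nested_sum x t" 1] by (intro p_cong_diff) auto
  also have "of_nat (p - x) * nested_sum x t - of_nat p * nested_sum x t = - (of_nat x * nested_sum x t)"
    using assms by (simp add: algebra_simps)
  finally have "- of_nat (x + t) * - (of_nat x * nested_sum x t) \<approx>\<^bsub>1\<^esub> - of_nat (x + t) *
     (- ((- 1) ^ t * of_nat (x + t - 1 choose t) * bernoulli (p - x - t)) - 0)"
    by (rule p_cong_scale[OF p_integral_uminus[OF p_integral_of_nat]])
  also have "- of_nat (x + t) * - (of_nat x * nested_sum x t) = of_nat x * (of_nat (x + t) * nested_sum x t)"
    by (simp add: algebra_simps)
  also have "- of_nat (x + t) *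
     (- ((- 1) ^ t * of_nat (x + t - 1 choose t) * bernoulli (p - x - t)) - 0) =
     (- 1) ^ t * of_nat ((x + t) * (x + t - 1 choose t)) * bernoulli (p - x - t)"
    by (simp only: of_nat_mult minus_mult_minus diff_0_right mult_ac)
  also have "(x + t) * (x + t - 1 choose t) = x * (x + t choose t)"
    using binomial_absorb_comp[of "x + t" t] by simp
  also have "(- 1) ^ t * of_nat (x * (x + t choose t)) * bernoulli (p - x - t) =
     of_nat x * ((- 1) ^ t * of_nat (x + t choose t) * bernoulli (p - x - t))"
    by simp
  finally show ?thesis
    by (rule p_cong_cancel[rotated]) (use assms in \<open>auto intro: p_unit_of_nat_less\<close>)
qed

definition harmonic_product_sum :: "nat \<Rightarrow> nat \<Rightarrow> rat" where
  "harmonic_product_sum x y = (\<Sum>i=1..p-1. gen_harmonic (int x) i * gen_harmonic (int y) i)"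

lemma harmonic_product_sum_cong:
  assumes "0 < x" "0 < y" "x + y < p"
  shows "harmonic_product_sum x y \<approx>\<^bsub>1\<^esub> - (nested_sum x (y - 1) + nested_sum y (x - 1))"
proof -
  define f where "f x = (\<lambda>j :: nat. (of_nat j :: rat) powi (- int x))" for x
  have gh: "gen_harmonic (int x) n = (\<Sum>j=1..n. f x j)" for x n
    by (simp add: gen_harmonic_def f_def)
  have absorb: "of_nat k * f x k = of_nat k powi (- int (x - 1))" if "0 < x" "0 < k" for x k
    using power_int_minus_mult[of "of_nat k :: rat" "- int (x - 1)"] that
    by (simp add: f_def mult.commute)
  have "harmonic_product_sum x y = of_nat (Suc (p - 1)) *
      (gen_harmonic (int x) (p - 1) * gen_harmonic (int y) (p - 1)) -
    (\<Sum>k=1..p-1. of_nat k * (gen_harmonic (int x) (k - 1) * f y k +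
        gen_harmonic (int y) (k - 1) * f x k + f x k * f y k))"
    unfolding harmonic_product_sum_def gh by (rule sum_prefix_sums_mult)
  also have "(\<Sum>k=1..p-1. of_nat k * (gen_harmonic (int x) (k - 1) * f y k +
        gen_harmonic (int y) (k - 1) * f x k + f x k * f y k)) =
      (\<Sum>k=1..p-1. of_nat k powi (- int (y - 1)) * gen_harmonic (int x) (k - 1) +
       of_nat k powi (- int (x - 1)) * gen_harmonic (int y) (k - 1) + of_nat k powi (- int (x + y - 1)))"
  proof (rule sum.cong[OF refl])
    fix k assume "k \<in> {1..p-1}"
    hence k: "0 < k" by auto
    have "f x k * f y k = f (x + y) k"
      using k by (simp add: f_def flip: power_int_add)
    hence "of_nat k * (gen_harmonic (int x) (k - 1) * f y k +
        gen_harmonic (int y) (k - 1) * f x k + f x k * f y k) =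
      (of_nat k * f y k) * gen_harmonic (int x) (k - 1) +
      (of_nat k * f x k) * gen_harmonic (int y) (k - 1) + of_nat k * f (x + y) k"
      by (simp add: algebra_simps)
    thus "of_nat k * (gen_harmonic (int x) (k - 1) * f y k +
        gen_harmonic (int y) (k - 1) * f x k + f x k * f y k) =
      of_nat k powi (- int (y - 1)) * gen_harmonic (int x) (k - 1) +
       of_nat k powi (- int (x - 1)) * gen_harmonic (int y) (k - 1) + of_nat k powi (- int (x + y - 1))"
      using assms k by (simp only: absorb) 
  qed
  also have "\<dots> = nested_sum x (y - 1) + nested_sum y (x - 1) + power_sum (- int (x + y - 1))"
    by (simp only: sum.distrib nested_sum_def power_sum_def)
  finally have eq: "harmonic_product_sum x y =
     of_nat p ^ 1 * (gen_harmonic (int x) (p - 1) * gen_harmonic (int y) (p - 1)) -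
     (nested_sum x (y - 1) + nested_sum y (x - 1) + power_sum (- int (x + y - 1)))"
    using p_pos by simp
  have "power_sum (- int (x + y - 1)) \<approx>\<^bsub>1\<^esub> 0"
    using assms by (intro power_sum_cong_0 p_minus_1_not_dvd) auto
  hence "harmonic_product_sum x y \<approx>\<^bsub>1\<^esub> 0 - (nested_sum x (y - 1) + nested_sum y (x - 1) + 0)"
    unfolding eq using p_pos by (intro p_cong_diff p_cong_multiple p_cong_add) auto
  thus ?thesis by simp
qed

section \<open>Reversal of the summation order\<close>

lemma powi_reflect:
  assumes "j \<in> {1..p-1}"
  shows "of_nat (p - j) powi (- int a) \<approx>\<^bsub>2\<^esub> (- 1) ^ a *
    (of_nat j powi (- int a) + of_nat p * (of_nat a * of_nat j powi (- int (a + 1))))"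
proof -
  have neg: "(- x) powi (- int n) = (- 1) ^ n * x powi (- int n)" for x :: rat and n
    by (simp add: power_int_minus power_minus[of x] flip: power_inverse)
  have u: "p_unit (- of_nat j)" using unit_residue[OF assms] by (rule p_unit_uminus)
  have "of_nat (p - j) = (- of_nat j + of_nat p * 1 :: rat)" using assms by auto
  hence "of_nat (p - j) powi (- int a) \<approx>\<^bsub>2\<^esub> (- of_nat j) powi (- int a) +
      of_nat p * (of_int (- int a) * 1 * (- of_nat j) powi (- int a - 1))"
    by (simp only: powi_expand[OF u p_integral_1])
  also have "- int a - 1 = - int (a + 1)" by simp
  finally show ?thesis unfolding neg by (simp add: algebra_simps)
qed

text \<open>\<open>gen_harmonic a (p - 1 - i)\<close> is the full sum without its last \<open>i\<close> terms, the reciprocals of powers of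
  \<open>p - j\<close> for \<open>j\<close> from \<open>1\<close> to \<open>i\<close>.\<close>

lemma gen_harmonic_reflect:
  assumes "i < p"
  shows "gen_harmonic (int a) (p - 1 - i) \<approx>\<^bsub>2\<^esub> gen_harmonic (int a) (p - 1) - (- 1) ^ a *
    (gen_harmonic (int a) i + of_nat p * (of_nat a * gen_harmonic (int (a + 1)) i))"
proof -
  have "gen_harmonic (int a) (p - 1) = gen_harmonic (int a) (p - 1 - i) +
      (\<Sum>j=1..i. of_nat (p - j) powi (- int a))"
  proof -
    have "{1..p-1} = {1..p-1-i} \<union> {p-i..p-1}" using assms by auto
    hence "gen_harmonic (int a) (p - 1) = gen_harmonic (int a) (p - 1 - i) +
        (\<Sum>j=p-i..p-1. of_nat j powi (- int a))"
      unfolding gen_harmonic_def by (simp only:) (rule sum.union_disjoint; force)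
    also have "(\<Sum>j=p-i..p-1. of_nat j powi (- int a)) = (\<Sum>j=1..i. of_nat (p - j) powi (- int a) :: rat)"
      using assms by (intro sum.reindex_bij_witness[of _ "\<lambda>j. p - j" "\<lambda>j. p - j"]) auto
    finally show ?thesis .
  qed
  hence "gen_harmonic (int a) (p - 1 - i) = gen_harmonic (int a) (p - 1) -
      (\<Sum>j=1..i. of_nat (p - j) powi (- int a))" by simp
  also have "\<dots> \<approx>\<^bsub>2\<^esub> gen_harmonic (int a) (p - 1) - (\<Sum>j=1..i. (- 1) ^ a *
    (of_nat j powi (- int a) + of_nat p * (of_nat a * of_nat j powi (- int (a + 1)))))"
    using assms p_pos by (intro p_cong_diff p_cong_sum powi_reflect p_cong_refl gen_harmonic_integral) auto
  also have "(\<Sum>j=1..i. (- 1) ^ a *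
    (of_nat j powi (- int a) + of_nat p * (of_nat a * of_nat j powi (- int (a + 1))))) =
    (- 1) ^ a * (gen_harmonic (int a) i + of_nat p * (of_nat a * gen_harmonic (int (a + 1)) i))"
    unfolding gen_harmonic_def by (simp only: sum_distrib_left[symmetric] sum.distrib)
  finally show ?thesis .
qed

lemma gen_harmonic_eq_power_sum: "gen_harmonic (int a) (p - 1) = power_sum (- int a)"
  by (simp add: gen_harmonic_def power_sum_def)

lemma sum_gen_harmonic_cong:
  assumes "0 < b" "b < p"
  shows "(\<Sum>i=1..p-1. gen_harmonic (int b) i) \<approx>\<^bsub>1\<^esub> - power_sum (- int (b - 1))"
proof -
  have absorb: "of_nat k * of_nat k powi (- int b) = (of_nat k powi (- int (b - 1)) :: rat)"
    if "0 < k" for k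
    using power_int_minus_mult[of "of_nat k :: rat" "- int (b - 1)"] that assms
    by (simp add: mult.commute)
  have "(\<Sum>i=1..p-1. gen_harmonic (int b) i) = of_nat (Suc (p - 1)) * gen_harmonic (int b) (p - 1) -
      (\<Sum>k=1..p-1. of_nat k * of_nat k powi (- int b))"
    unfolding gen_harmonic_def by (rule sum_prefix_sums)
  also have "(\<Sum>k=1..p-1. of_nat k * of_nat k powi (- int b) :: rat) = power_sum (- int (b - 1))"
    unfolding power_sum_def using absorb by (intro sum.cong) auto
  also have "of_nat (Suc (p - 1)) * gen_harmonic (int b) (p - 1) - power_sum (- int (b - 1)) =
     - power_sum (- int (b - 1)) + of_nat p * gen_harmonic (int b) (p - 1)"
    using p_pos by simp
  also have "\<dots> \<approx>\<^bsub>1\<^esub> - power_sum (- int (b - 1))"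
    using p_pos by (intro p_cong_shift) auto
  finally show ?thesis .
qed

lemma sum_lessThan_gen_harmonic:
  assumes "f 0 = (0 :: rat)"
  shows "(\<Sum>i<p. f i) = (\<Sum>i=1..p-1. f i)"
  using assms p_pos by (intro sum.mono_neutral_right) (auto simp: not_le less_Suc_eq_0_disj)

text \<open>Reversal of the summation. The parities make the two reflection signs \<open>- 1\<close> and \<open>1\<close>, so \<open>S\<close> reappears
  with a minus sign. The boundary values \<open>power_sum (- a)\<close> and \<open>power_sum (- b)\<close> are divisible by
  \<open>p\<close>, so a term containing one of them vanishes modulo \<open>p\<^sup>2\<close> once it has a second such factor. One
  boundary term is kept: the sum of the \<open>B i\<close> next to \<open>power_sum (- a)\<close> is a unit when \<open>b = 1\<close>.\<close>

lemma twice_harmonic_product_sum: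
  assumes "0 < a" "0 < b" "even a" "odd b" "a + b + 2 \<le> p"
  shows "2 * harmonic_product_sum a b \<approx>\<^bsub>2\<^esub>
    - (of_nat p * (of_nat a * harmonic_product_sum (a + 1) b + of_nat b * harmonic_product_sum a (b + 1)))
    + power_sum (- int a) * (\<Sum>i=1..p-1. gen_harmonic (int b) i)"
proof -
  define A where "A = gen_harmonic (int a)"
  define A' where "A' = gen_harmonic (int (a + 1))"
  define B where "B = gen_harmonic (int b)"
  define B' where "B' = gen_harmonic (int (b + 1))"
  define h where "h = A (p - 1)"
  define h' where "h' = B (p - 1)"
  have h0: "h \<approx>\<^bsub>1\<^esub> 0" and h'0: "h' \<approx>\<^bsub>1\<^esub> 0"
    unfolding h_def h'_def A_def B_def gen_harmonic_eq_power_sum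
    by (rule power_sum_cong_0[OF p_minus_1_not_dvd]; use assms in simp)+
  have int: "p_integral (A i)" "p_integral (A' i)" "p_integral (B i)" "p_integral (B' i)" if "i < p" for i
    using that by (auto simp: A_def A'_def B_def B'_def)
  have hint: "p_integral h" "p_integral h'"
    using p_cong_integral_left[OF h0] p_cong_integral_left[OF h'0] by auto
  have zero: "A 0 = 0" "B 0 = 0" by (auto simp: A_def B_def gen_harmonic_def)
  \<comment> \<open>The index \<open>i = 0\<close> is included because only the range from \<open>0\<close> to \<open>p - 1\<close> is stable under
    reversal; its term is zero.\<close>
  have pointwise: "A (p - Suc i) * B (p - Suc i) \<approx>\<^bsub>2\<^esub>
      - (A i * B i + of_nat p * (of_nat a * (A' i * B i) + of_nat b * (A i * B' i))) + h * B i - h' * A i"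
    if i: "i < p" for i
  proof -
    have "A (p - Suc i) \<approx>\<^bsub>2\<^esub> h - (A i + of_nat p * (of_nat a * A' i))"
      using gen_harmonic_reflect[OF i, of a] assms unfolding h_def A_def A'_def by simp
    moreover have "B (p - Suc i) \<approx>\<^bsub>2\<^esub> h' + (B i + of_nat p * (of_nat b * B' i))"
      using gen_harmonic_reflect[OF i, of b] assms unfolding h'_def B_def B'_def
      by (simp add: algebra_simps)
    ultimately have "A (p - Suc i) * B (p - Suc i) \<approx>\<^bsub>2\<^esub>
       (h - (A i + of_nat p * (of_nat a * A' i))) * (h' + (B i + of_nat p * (of_nat b * B' i)))"
      by (rule p_cong_mult)
    also have "\<dots> = (- (A i * B i + of_nat p * (of_nat a * (A' i * B i) + of_nat b * (A i * B' i)))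
        + h * B i - h' * A i) +
      (h * h' + of_nat p * h * (of_nat b * B' i) - of_nat p * h' * (of_nat a * A' i)
        - of_nat p ^ 2 * (of_nat a * of_nat b * A' i * B' i))"
      by (simp add: algebra_simps power2_eq_square)
    also have "\<dots> \<approx>\<^bsub>2\<^esub> (- (A i * B i + of_nat p * (of_nat a * (A' i * B i) + of_nat b * (A i * B' i)))
        + h * B i - h' * A i) +
      (0 + of_nat p * 0 * (of_nat b * B' i) - of_nat p * 0 * (of_nat a * A' i) - 0)"
    proof (rule p_cong_add)
      show "h * h' + of_nat p * h * (of_nat b * B' i) - of_nat p * h' * (of_nat a * A' i)
        - of_nat p ^ 2 * (of_nat a * of_nat b * A' i * B' i) \<approx>\<^bsub>2\<^esub>
        0 + of_nat p * 0 * (of_nat b * B' i) - of_nat p * 0 * (of_nat a * A' i) - 0"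
        using h0 h'0 int[OF i]
        by (intro p_cong_diff p_cong_add p_cong_mult_0_0 p_cong_multiple
              p_cong_mult[OF p_cong_lift[OF h0] p_cong_refl] p_cong_mult[OF p_cong_lift[OF h'0] p_cong_refl]) auto
    qed (use int[OF i] hint in auto)
    finally show ?thesis by simp
  qed
  have "harmonic_product_sum a b = (\<Sum>i<p. A i * B i)"
    unfolding harmonic_product_sum_def A_def[symmetric] B_def[symmetric]
    using zero by (intro sum_lessThan_gen_harmonic[symmetric]) simp
  also have "\<dots> = (\<Sum>i<p. A (p - Suc i) * B (p - Suc i))"
    by (rule sum.nat_diff_reindex[symmetric])
  also have "\<dots> \<approx>\<^bsub>2\<^esub> (\<Sum>i<p.
      - (A i * B i + of_nat p * (of_nat a * (A' i * B i) + of_nat b * (A i * B' i))) + h * B i - h' * A i)"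
    using pointwise by (intro p_cong_sum) auto
  also have "\<dots> = (\<Sum>i=1..p-1.
      - (A i * B i + of_nat p * (of_nat a * (A' i * B i) + of_nat b * (A i * B' i))) + h * B i - h' * A i)"
    using zero by (intro sum_lessThan_gen_harmonic) simp
  also have "\<dots> = - ((\<Sum>i=1..p-1. A i * B i) + of_nat p * (of_nat a * (\<Sum>i=1..p-1. A' i * B i) +
        of_nat b * (\<Sum>i=1..p-1. A i * B' i))) + h * (\<Sum>i=1..p-1. B i) - h' * (\<Sum>i=1..p-1. A i)"
    by (simp only: sum_subtractf sum.distrib sum_negf sum_distrib_left[symmetric])
  also have "\<dots> \<approx>\<^bsub>2\<^esub> - ((\<Sum>i=1..p-1. A i * B i) + of_nat p * (of_nat a * (\<Sum>i=1..p-1. A' i * B i) +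
        of_nat b * (\<Sum>i=1..p-1. A i * B' i))) + h * (\<Sum>i=1..p-1. B i) - 0"
  proof (rule p_cong_diff)
    have "(\<Sum>i=1..p-1. A i) \<approx>\<^bsub>1\<^esub> - power_sum (- int (a - 1))"
      unfolding A_def using assms by (intro sum_gen_harmonic_cong) auto
    also have "\<dots> \<approx>\<^bsub>1\<^esub> - 0"
      using assms by (intro p_cong_uminus power_sum_cong_0 p_minus_1_not_dvd) auto
    finally show "h' * (\<Sum>i=1..p-1. A i) \<approx>\<^bsub>2\<^esub> 0"
      using h'0 by (intro p_cong_mult_0_0) auto
  qed (use int hint p_pos in \<open>auto intro!: p_integral_add p_integral_diff p_integral_uminus p_integral_mult p_integral_sum p_cong_refl\<close>)
  finally have "harmonic_product_sum a b + harmonic_product_sum a b \<approx>\<^bsub>2\<^esub>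
      - (harmonic_product_sum a b + of_nat p * (of_nat a * harmonic_product_sum (a + 1) b +
        of_nat b * harmonic_product_sum a (b + 1))) + h * (\<Sum>i=1..p-1. B i) - 0
      + harmonic_product_sum a b"
    unfolding harmonic_product_sum_def A_def[symmetric] A'_def[symmetric] B_def[symmetric] B'_def[symmetric]
    by (rule p_cong_add) (use int in \<open>auto intro!: p_cong_refl p_integral_sum p_integral_mult\<close>)
  thus ?thesis
    by (simp add: h_def A_def B_def gen_harmonic_eq_power_sum[symmetric] del: of_nat_diff)
qed

section \<open>The congruence\<close>

text \<open>With \<open>c\<close> the common value of \<open>w choose a\<close> and \<open>w choose b\<close>, absorption gives
  \<open>b * c = (a + 1) * (w choose (b - 1))\<close> and \<open>a * c = (b + 1) * (w choose (a - 1))\<close>. This removes the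
  factors \<open>a\<close> and \<open>b\<close>, and Pascal's rule does the rest.\<close>

lemma choose_combination:
  assumes "0 < a" "0 < b"
  defines "w \<equiv> a + b"
  shows "of_nat a * (of_nat (w choose (b - 1)) + of_nat (w choose a)) -
      of_nat b * (of_nat (w choose b) + of_nat (w choose (a - 1))) =
    (of_nat (w + 1 choose a) - of_nat (w + 1 choose b) :: rat)"
proof -
  have step: "Suc k * (w choose Suc k) = (w - k) * (w choose k)" for k
    by (simp only: binomial_absorption binomial_absorb_comp)
  have "b * (w choose b) = (a + 1) * (w choose (b - 1))" "a * (w choose a) = (b + 1) * (w choose (a - 1))"
    using step[of "b - 1"] step[of "a - 1"] assms by (simp_all add: w_def)
  hence 1: "of_nat b * of_nat (w choose b) = ((of_nat a + 1) * of_nat (w choose (b - 1)) :: rat)"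
    "of_nat a * of_nat (w choose a) = ((of_nat b + 1) * of_nat (w choose (a - 1)) :: rat)"
    by (metis of_nat_mult of_nat_add of_nat_1)+
  have "(w choose a) = (w choose b)" 
    using binomial_symmetric[of a w] by (simp add: w_def)
  moreover have "w + 1 choose a = (w choose (a - 1)) + (w choose a)" "w + 1 choose b = (w choose (b - 1)) + (w choose b)"
    using assms by (cases a; cases b; simp)+
  ultimately show ?thesis using 1 by (simp add: algebra_simps)
qed

lemma harmonic_product_sum_bernoulli:
  assumes "0 < a" "0 < b" "even a" "odd b" "a + b + 2 \<le> p"
  shows "harmonic_product_sum a b \<approx>\<^bsub>2\<^esub>
    - (of_int (coeff_k a b) / (2 * of_nat (a + b))) * of_nat p * bernoulli (p - a - b)"
proof -
  define w where "w = a + b"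
  define \<beta> where "\<beta> = bernoulli (p - a - b)"
  have \<beta>: "p_integral \<beta>" unfolding \<beta>_def using assms by (intro bernoulli_integral) auto
  have p_sub: "p - b - a = p - a - b" "p - (a + 1) - (b - 1) = p - a - b" "p - (b + 1) - (a - 1) = p - a - b"
    using assms by auto
  have w_eq: "b + a = w" "a + 1 + (b - 1) = w" "b + 1 + (a - 1) = w" "a + b = w"
    using assms by (auto simp: w_def)
  have Fba: "of_nat w * nested_sum b a \<approx>\<^bsub>1\<^esub> of_nat (w choose a) * \<beta>"
    using nested_sum_cong[of b a] assms unfolding w_eq p_sub \<beta>_def by simp
  have Fab: "of_nat w * nested_sum a b \<approx>\<^bsub>1\<^esub> - of_nat (w choose b) * \<beta>"
    using nested_sum_cong[of a b] assms unfolding w_eq p_sub \<beta>_def by simp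
  have "a - 1 > 0" "odd (a - 1)" using assms by (auto elim!: evenE)
  hence Fba': "of_nat w * nested_sum (b + 1) (a - 1) \<approx>\<^bsub>1\<^esub> - of_nat (w choose (a - 1)) * \<beta>"
    using nested_sum_cong[of "b + 1" "a - 1"] assms unfolding w_eq p_sub \<beta>_def by simp
  have M1: "of_nat w * harmonic_product_sum (a + 1) b \<approx>\<^bsub>1\<^esub>
      - (of_nat w * nested_sum (a + 1) (b - 1)) - of_nat (w choose a) * \<beta>"
  proof -
    have "of_nat w * harmonic_product_sum (a + 1) b \<approx>\<^bsub>1\<^esub>
        of_nat w * - (nested_sum (a + 1) (b - 1) + nested_sum b (a + 1 - 1))"
      using assms by (intro p_cong_scale[OF p_integral_of_nat harmonic_product_sum_cong]) auto
    also have "\<dots> = - (of_nat w * nested_sum (a + 1) (b - 1)) - of_nat w * nested_sum b a"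
      by (simp add: algebra_simps)
    also have "\<dots> \<approx>\<^bsub>1\<^esub> - (of_nat w * nested_sum (a + 1) (b - 1)) - of_nat (w choose a) * \<beta>"
      by (rule p_cong_diff[OF p_cong_refl Fba]) auto
    finally show ?thesis .
  qed
  have M2: "of_nat w * harmonic_product_sum a (b + 1) \<approx>\<^bsub>1\<^esub>
      - (- of_nat (w choose b) * \<beta>) - (- of_nat (w choose (a - 1)) * \<beta>)"
  proof -
    have "of_nat w * harmonic_product_sum a (b + 1) \<approx>\<^bsub>1\<^esub>
        of_nat w * - (nested_sum a (b + 1 - 1) + nested_sum (b + 1) (a - 1))"
      using assms by (intro p_cong_scale[OF p_integral_of_nat harmonic_product_sum_cong]) auto
    also have "\<dots> = - (of_nat w * nested_sum a b) - of_nat w * nested_sum (b + 1) (a - 1)"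
      by (simp add: algebra_simps)
    also have "\<dots> \<approx>\<^bsub>1\<^esub> - (- of_nat (w choose b) * \<beta>) - (- of_nat (w choose (a - 1)) * \<beta>)"
      by (intro p_cong_diff p_cong_uminus Fab Fba')
    finally show ?thesis .
  qed
  \<comment> \<open>The only place where \<open>b = 1\<close> differs: the first summand contributes everything when \<open>b > 1\<close>, the
    second when \<open>b = 1\<close>, with the same result.\<close>
  have boundary: "of_nat p * (of_nat a * (of_nat w * nested_sum (a + 1) (b - 1))) +
      of_nat w * (power_sum (- int a) * (\<Sum>i=1..p-1. gen_harmonic (int b) i)) \<approx>\<^bsub>2\<^esub>
      of_nat p * (of_nat a * (of_nat (w choose (b - 1)) * \<beta>))"
  proof -
    have Ha: "power_sum (- int a) \<approx>\<^bsub>1\<^esub> 0"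
      using assms by (intro power_sum_cong_0 p_minus_1_not_dvd) auto
    have HB: "(\<Sum>i=1..p-1. gen_harmonic (int b) i) \<approx>\<^bsub>1\<^esub> - power_sum (- int (b - 1))"
      using assms by (intro sum_gen_harmonic_cong) auto
    show ?thesis
    proof (cases "b = 1")
      case True
      have "nested_sum (a + 1) (b - 1) \<approx>\<^bsub>1\<^esub> 0"
        using nested_sum_cong_0[of "a + 1"] assms True by simp
      hence 1: "of_nat p * (of_nat a * (of_nat w * nested_sum (a + 1) (b - 1))) \<approx>\<^bsub>2\<^esub>
          of_nat p * (of_nat a * (of_nat w * 0))"
        by (rule p_cong_lift[OF p_cong_scale[OF p_integral_of_nat p_cong_scale[OF p_integral_of_nat]]])
      have "- power_sum (- int (b - 1)) \<approx>\<^bsub>1\<^esub> - (- 1)"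
        using True by (intro p_cong_uminus power_sum_cong_minus_1) simp
      with HB have "(\<Sum>i=1..p-1. gen_harmonic (int b) i) \<approx>\<^bsub>1\<^esub> 1"
        using p_cong_trans by fastforce
      hence "of_nat w * (power_sum (- int a) * (\<Sum>i=1..p-1. gen_harmonic (int b) i)) \<approx>\<^bsub>2\<^esub>
          of_nat w * (power_sum (- int a) * 1)"
        by (rule p_cong_scale[OF p_integral_of_nat p_cong_mult_0_cong[OF Ha]])
      also have "\<dots> = of_nat (a + 1) * power_sum (- int a)" by (simp add: w_def True)
      also have "\<dots> \<approx>\<^bsub>2\<^esub> of_nat a * (of_nat p * bernoulli (p - 1 - a))"
        using assms True by (intro power_sum_negative) auto
      also have "\<dots> = of_nat p * (of_nat a * (of_nat (w choose (b - 1)) * \<beta>))"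
        by (simp add: True \<beta>_def diff_commute)
      finally show ?thesis
        using p_cong_add[OF 1] by fastforce
    next
      case False
      have b: "b - 1 > 0" "even (b - 1)" using assms False by auto
      have F: "of_nat w * nested_sum (a + 1) (b - 1) \<approx>\<^bsub>1\<^esub> of_nat (w choose (b - 1)) * \<beta>"
        using nested_sum_cong[of "a + 1" "b - 1"] assms b unfolding w_eq p_sub \<beta>_def by simp
      have "- power_sum (- int (b - 1)) \<approx>\<^bsub>1\<^esub> - 0"
        using assms b by (intro p_cong_uminus power_sum_cong_0 p_minus_1_not_dvd) auto
      with HB have "(\<Sum>i=1..p-1. gen_harmonic (int b) i) \<approx>\<^bsub>1\<^esub> 0"
        using p_cong_trans by fastforce
      with Ha have "of_nat w * (power_sum (- int a) * (\<Sum>i=1..p-1. gen_harmonic (int b) i)) \<approx>\<^bsub>2\<^esub> of_nat w * 0"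
        by (intro p_cong_scale[OF p_integral_of_nat] p_cong_mult_0_0)
      from p_cong_add[OF p_cong_lift[OF p_cong_scale[OF p_integral_of_nat F]] this]
      show ?thesis by simp
    qed
  qed
  have "of_nat w * (2 * harmonic_product_sum a b) \<approx>\<^bsub>2\<^esub> of_nat w *
    (- (of_nat p * (of_nat a * harmonic_product_sum (a + 1) b + of_nat b * harmonic_product_sum a (b + 1)))
    + power_sum (- int a) * (\<Sum>i=1..p-1. gen_harmonic (int b) i))"
    using assms by (intro p_cong_scale[OF p_integral_of_nat twice_harmonic_product_sum])
  also have "\<dots> = - (of_nat p * (of_nat a * (of_nat w * harmonic_product_sum (a + 1) b) +
        of_nat b * (of_nat w * harmonic_product_sum a (b + 1))))
    + of_nat w * (power_sum (- int a) * (\<Sum>i=1..p-1. gen_harmonic (int b) i))"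
    by (simp add: algebra_simps)
  also have "\<dots> \<approx>\<^bsub>2\<^esub>
    - (of_nat p * (of_nat a * (- (of_nat w * nested_sum (a + 1) (b - 1)) - of_nat (w choose a) * \<beta>) +
        of_nat b * (- (- of_nat (w choose b) * \<beta>) - (- of_nat (w choose (a - 1)) * \<beta>))))
    + of_nat w * (power_sum (- int a) * (\<Sum>i=1..p-1. gen_harmonic (int b) i))"
    by (rule p_cong_add[OF p_cong_uminus[OF p_cong_lift[OF p_cong_add[OF
          p_cong_scale[OF p_integral_of_nat M1] p_cong_scale[OF p_integral_of_nat M2]]]] p_cong_refl])
      (use p_pos in \<open>auto intro!: p_integral_sum p_integral_mult\<close>)
  also have "\<dots> = (of_nat p * (of_nat a * (of_nat w * nested_sum (a + 1) (b - 1))) +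
      of_nat w * (power_sum (- int a) * (\<Sum>i=1..p-1. gen_harmonic (int b) i))) +
      of_nat p * (of_nat a * of_nat (w choose a) -
        of_nat b * (of_nat (w choose b) + of_nat (w choose (a - 1)))) * \<beta>"
    by (simp add: algebra_simps)
  also have "\<dots> \<approx>\<^bsub>2\<^esub> of_nat p * (of_nat a * (of_nat (w choose (b - 1)) * \<beta>)) +
      of_nat p * (of_nat a * of_nat (w choose a) -
        of_nat b * (of_nat (w choose b) + of_nat (w choose (a - 1)))) * \<beta>"
    using \<beta> by (intro p_cong_add[OF boundary p_cong_refl]) auto
  also have "\<dots> = of_nat p * (of_nat a * (of_nat (w choose (b - 1)) + of_nat (w choose a)) -
        of_nat b * (of_nat (w choose b) + of_nat (w choose (a - 1)))) * \<beta>"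
    by (simp add: algebra_simps)
  also have "\<dots> = of_nat p * - of_int (coeff_k a b) * \<beta>"
    using choose_combination[OF assms(1,2)] assms(3) by (simp add: w_def coeff_k_def)
  also have "\<dots> = of_nat w * (2 * (- (of_int (coeff_k a b) / (2 * of_nat w)) * of_nat p * \<beta>))"
  proof -
    have "of_nat w \<noteq> (0 :: rat)" using assms by (simp add: w_def)
    thus ?thesis by simp
  qed
  finally have "of_nat (w * 2) * harmonic_product_sum a b \<approx>\<^bsub>2\<^esub>
     of_nat (w * 2) * (- (of_int (coeff_k a b) / (2 * of_nat w)) * of_nat p * \<beta>)"
    by (simp only: of_nat_mult of_nat_numeral mult.assoc)
  moreover have "p_unit (of_nat (w * 2))"
    unfolding of_nat_mult w_def
    using assms by (intro p_unit_mult p_unit_of_nat_less) auto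
  ultimately have "harmonic_product_sum a b \<approx>\<^bsub>2\<^esub>
      - (of_int (coeff_k a b) / (2 * of_nat w)) * of_nat p * \<beta>"
    by (rule p_cong_cancel[rotated])
  thus ?thesis by (simp add: w_def \<beta>_def)
qed

end

theorem mainTheorem5:
  fixes a b p :: nat
  assumes "a > 0" and "b > 0"
    and "even a \<longleftrightarrow> odd b"
    and "prime p"
    and "p \<ge> a + b + 2"
  shows "rat_cong p 2
           (\<Sum>i=1..p-1. gen_harmonic (int a) i * gen_harmonic (int b) i)
           (- (of_int (coeff_k a b) / (2 * of_nat (a + b))) * of_nat p * bernoulli (p - a - b))"
proof -
  interpret prime_modulus p
    using assms(4) by unfold_locales
  show ?thesis
  proof (cases "even a")
    case True
    with assms show ?thesis
      using harmonic_product_sum_bernoulli[of a b] by (simp add: harmonic_product_sum_def)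
  next
    case False
    have swap: "coeff_k b a = coeff_k a b" "b + a = a + b" "p - b - a = p - a - b"
      using False assms(3) by (simp_all add: coeff_k_def add.commute)
    have "harmonic_product_sum b a = harmonic_product_sum a b"
      by (simp add: harmonic_product_sum_def mult.commute)
    moreover have "rat_cong p 2 (harmonic_product_sum b a)
        (- (of_int (coeff_k a b) / (2 * of_nat (a + b))) * of_nat p * bernoulli (p - a - b))"
      using harmonic_product_sum_bernoulli[of b a] False assms unfolding swap by simp
    ultimately show ?thesis
      by (simp only: harmonic_product_sum_def)
  qed
qed

end
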